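(* Let $d\ge 2$ be an integer, let $p>d$ be a prime, let $q=p^n$ with $n\ge 1$ an integer, and let $\Gamma=\{(\xi,\xi^2,\ldots,\xi^d):\xi\in\mathbb{F}_q\}\subset\mathbb{F}_q^{d}$ be the moment curve. Assume that $$q\ge\frac{d(d-1)}{2\log 6}+\frac{2d-1}{3}.$$ Then for every function $f:\Gamma\to\mathbb{C}$, $$\|(f\sigma)^{\vee}\|_{L^{2d}(\mathbb{F}_q^d,\mathrm{d}\mathbf{x})}\le\left(\frac{1}{q^d}\sum_{\ell\in\mathcal{P}_d}\binom{d}{\ell}^2\binom{q}{b(\ell)}\right)^{\frac{1}{2d}}\|f\|_{L^2(\Gamma,\mathrm{d}\sigma)},$$ and this inequality is sharp, i.e. the constant on the right-hand side cannot be replaced by any smaller one. Moreover, a non-zero function $f:\Gamma\to\mathbb{C}$ is a maximizer of this inequality (i.e. attains equality) if and only if $|f|$ is constant on $\Gamma$.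
   Context: $\log$ denotes the natural logarithm. $\mathbb{F}_q$ is the finite field with $q=p^n$ elements. Let $\mathrm{Tr}:\mathbb{F}_q\to\mathbb{F}_p$, $\mathrm{Tr}(y)=y+y^p+\cdots+y^{p^{n-1}}$, and $e(y)=\exp(2\pi i\,\mathrm{Tr}(y)/p)$ for $y\in\mathbb{F}_q$. For $\mathbf{x},\boldsymbol{\xi}\in\mathbb{F}_q^d$ put $\mathbf{x}\cdot\boldsymbol{\xi}=\sum_{i=1}^d x_i\xi_i$. The measure $\mathrm{d}\mathbf{x}$ is counting measure on $\mathbb{F}_q^d$, and $\sigma$ is the normalized counting measure on $\Gamma$ (note $|\Gamma|=q$). For $f:\Gamma\to\mathbb{C}$ the extension operator is $$(f\sigma)^{\vee}(\mathbf{x})=\frac1q\sum_{\boldsymbol{\xi}\in\Gamma}f(\boldsymbol{\xi})\,e(\mathbf{x}\cdot\boldsymbol{\xi}),\qquad \mathbf{x}\in\mathbb{F}_q^d.$$ Thus $\|(f\sigma)^\vee\|_{L^{2d}(\mathbb{F}_q^d,\mathrm{d}\mathbf{x})}=\left(\sum_{\mathbf{x}\in\mathbb{F}_q^d}|(f\sigma)^\vee(\mathbf{x})|^{2d}\right)^{1/(2d)}$ and $\|f\|_{L^2(\Gamma,\mathrm{d}\sigma)}=\left(\frac1q\sum_{\boldsymbol{\xi}\in\Gamma}|f(\boldsymbol{\xi})|^2\right)^{1/2}$. $\mathcal{P}_d=\{\ell=(\ell_1,\ldots,\ell_d)\in\mathbb{Z}^d:\ \ell_1\ge\ell_2\ge\cdots\ge\ell_d\ge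 0,\ \ell_1+\cdots+\ell_d=d\}$ is the set of partitions of $d$. For $\ell\in\mathcal{P}_d$ let $b(\ell)=(b_0(\ell),b_1(\ell),\ldots,b_d(\ell))$, where $b_j(\ell)=|\{1\le i\le d:\ell_i=j\}|$ for $1\le j\le d$ and $b_0(\ell)=|\{1\le i\le d:\ell_i=0\}|+(q-d)$. The multinomial coefficients are $$\binom{d}{\ell}=\frac{d!}{\ell_1!\,\ell_2!\cdots\ell_d!},\qquad \binom{q}{b(\ell)}=\frac{q!}{b_0(\ell)!\,b_1(\ell)!\cdots b_d(\ell)!}.$$ A maximizer is a non-zero function for which equality holds in the inequality. *)

theory Defs
  imports
    Complex_Main
    "HOL-Library.FuncSet"
    "HOL-Library.Cardinality"
    "HOL-Computational_Algebra.Primes"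
begin

(* The field with q = p ^ n elements is an arbitrary type 'a of sort {finite, field} with
   CARD('a) = p ^ n; such a field automatically has characteristic p.  Vectors over it with d
   coordinates are extensional functions on the index set {1..d}. *)

definition field_trace :: "nat \<Rightarrow> nat \<Rightarrow> 'a::field \<Rightarrow> 'a" where
  "field_trace p n y = (\<Sum>k<n. y ^ (p ^ k))"

(* The trace is an element of the prime field, viewed inside 'a.  In exp (2 pi i Tr(y) / p) it
   stands for its representative in {0, ..., p - 1}. *)
definition prime_field_rep :: "nat \<Rightarrow> 'a::field \<Rightarrow> nat" where
  "prime_field_rep p z = (THE k. k < p \<and> of_nat k = z)"

definition add_char :: "nat \<Rightarrow> nat \<Rightarrow> 'a::field \<Rightarrow> complex" where
  "add_char p n y =
     exp (2 * of_real pi * \<i> * of_nat (prime_field_rep p (field_trace p n y)) / of_nat p)"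

definition vectors :: "nat \<Rightarrow> (nat \<Rightarrow> 'a) set" where
  "vectors d = {1..d} \<rightarrow>\<^sub>E UNIV"

definition dot :: "nat \<Rightarrow> (nat \<Rightarrow> 'a::field) \<Rightarrow> (nat \<Rightarrow> 'a) \<Rightarrow> 'a" where
  "dot d x \<xi> = (\<Sum>i=1..d. x i * \<xi> i)"

definition moment_curve :: "nat \<Rightarrow> (nat \<Rightarrow> 'a::field) set" where
  "moment_curve d = range (\<lambda>t. \<lambda>i\<in>{1..d}. t ^ i)"

(* Functions on the moment curve are total functions on nat => 'a of which only the values on the
   curve are used. *)
definition extension_op ::
    "nat \<Rightarrow> nat \<Rightarrow> nat \<Rightarrow> ((nat \<Rightarrow> 'a::{finite, field}) \<Rightarrow> complex) \<Rightarrow> (nat \<Rightarrow> 'a) \<Rightarrow> complex" where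
  "extension_op p n d f x =
     1 / of_nat CARD('a) * (\<Sum>\<xi>\<in>moment_curve d. f \<xi> * add_char p n (dot d x \<xi>))"

definition Lp_norm_vectors ::
    "real \<Rightarrow> nat \<Rightarrow> ((nat \<Rightarrow> 'a::{finite, field}) \<Rightarrow> complex) \<Rightarrow> real" where
  "Lp_norm_vectors r d g = (\<Sum>x\<in>vectors d. cmod (g x) powr r) powr (1 / r)"

definition L2_norm_curve :: "nat \<Rightarrow> ((nat \<Rightarrow> 'a::{finite, field}) \<Rightarrow> complex) \<Rightarrow> real" where
  "L2_norm_curve d f = sqrt (1 / real CARD('a) * (\<Sum>\<xi>\<in>moment_curve d. (cmod (f \<xi>))\<^sup>2))"

definition partitions_of :: "nat \<Rightarrow> (nat \<Rightarrow> nat) set" where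
  "partitions_of d =
     {l \<in> {1..d} \<rightarrow>\<^sub>E UNIV. antimono_on {1..d} l \<and> (\<Sum>i=1..d. l i) = d}"

definition part_mult :: "nat \<Rightarrow> nat \<Rightarrow> (nat \<Rightarrow> nat) \<Rightarrow> nat \<Rightarrow> nat" where
  "part_mult q d l j = card {i \<in> {1..d}. l i = j} + (if j = 0 then q - d else 0)"

definition multinomial :: "nat \<Rightarrow> nat set \<Rightarrow> (nat \<Rightarrow> nat) \<Rightarrow> real" where
  "multinomial m I k = fact m / (\<Prod>i\<in>I. fact (k i))"

definition sharp_const :: "nat \<Rightarrow> nat \<Rightarrow> real" where
  "sharp_const q d =
     (1 / real q ^ d *
        (\<Sum>l\<in>partitions_of d.
           (multinomial d {1..d} l)\<^sup>2 * multinomial q {0..d} (part_mult q d l)))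
     powr (1 / (2 * real d))"

end

theory Submission
  imports
    Defs
    "HOL-Computational_Algebra.Polynomial_FPS"
    "HOL-Library.Multiset"
begin

text \<open>
  Write \<open>g t\<close> for the value of \<open>f\<close> at the point \<open>(t, t\<^sup>2, \<dots>, t\<^sup>d)\<close> and \<open>a t = \<bar>g t\<bar>\<^sup>2\<close>.

  The \<open>d\<close>-th power of the extension of \<open>f\<close> expands, by the multinomial theorem, into characters
  indexed by multiplicity functions \<open>b\<close> on the field of total mass \<open>d\<close>; the frequency belonging to
  \<open>b\<close> consists of the power sums \<open>\<Sum>t. b t * t ^ j\<close> for \<open>j = 1, \<dots>, d\<close>.  As the characteristic exceeds
  \<open>d\<close>, these power sums determine \<open>b\<close> (Newton; theorem \<open>power_sums_determine_multiplicities\<close>), so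
  distinct \<open>b\<close> contribute orthogonal characters and the \<open>2d\<close>-th power of the \<open>L\<^sup>2\<^sup>d\<close> norm is exactly
  \<open>q\<^sup>-\<^sup>d \<Sum>b. (d! / \<Prod>t. b t !)\<^sup>2 * (\<Prod>t. a t ^ b t)\<close> (lemma \<open>sum_cmod_extension_power\<close>).  Up to the factor
  \<open>q\<^sup>-\<^sup>d d!\<^sup>2\<close> this is the coefficient of \<open>X\<^sup>d\<close> in \<open>\<Prod>t. G (a t)\<close> with \<open>G a = \<Sum>k. a ^ k X ^ k / k!\<^sup>2\<close>.

  It remains to maximize that coefficient over nonnegative \<open>a\<close> with a prescribed mean \<open>\<mu>\<close>.
  The coefficient of \<open>X\<^sup>m\<close> in \<open>G u * G v\<close> equals \<open>1 / m!\<^sup>2\<close> times the coefficient of \<open>X\<^sup>m\<close> in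
  \<open>((1 + u X) (1 + v X)) ^ m = (1 + (u + v) X + u v X\<^sup>2) ^ m\<close>, hence is a polynomial with nonnegative
  coefficients in \<open>u + v\<close> and \<open>u v\<close>.  Replacing two entries \<open>u < \<mu> < v\<close> by \<open>\<mu>\<close> and \<open>u + v - \<mu>\<close> keeps their
  sum and enlarges their product, so it strictly increases the coefficient (lemma
  \<open>prod_bessel_fps_smoothing\<close>); finitely many such steps lead to the constant function
  (lemma \<open>prod_bessel_fps_less_mean\<close>).  Hence constant \<open>\<bar>g\<bar>\<close> gives the maximum and nothing else does.

  For \<open>a = 1\<close> the coefficient is evaluated by grouping the multiplicity functions by the
  partition of \<open>d\<close> that they induce (theorem \<open>sum_partitions_eq\<close>), which yields the constant.
\<close>

section \<open>Weak compositions and the multinomial theorem\<close>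

text \<open>
  Functions from \<open>A\<close> to the naturals with total mass \<open>m\<close>, extended by \<open>0\<close> outside \<open>A\<close>; equivalently,
  multisets of size \<open>m\<close> over \<open>A\<close>, given by their multiplicities.
\<close>
definition weak_compositions :: "'i set \<Rightarrow> nat \<Rightarrow> ('i \<Rightarrow> nat) set" where
  "weak_compositions A m = {b. (\<forall>t. t \<notin> A \<longrightarrow> b t = 0) \<and> sum b A = m}"

lemma weak_compositions_empty:
  "weak_compositions {} m = (if m = 0 then {\<lambda>_. 0} else {})"
  by (auto simp: weak_compositions_def)

lemma weak_compositions_le:
  assumes "finite A" "b \<in> weak_compositions A m"
  shows "b t \<le> m"
proof (cases "t \<in> A")
  case True
  then show ?thesis
    using assms member_le_sum[of t A b] by (auto simp: weak_compositions_def)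
qed (use assms in \<open>auto simp: weak_compositions_def\<close>)

lemma finite_weak_compositions:
  assumes "finite A"
  shows "finite (weak_compositions A m)"
proof (rule finite_subset)
  show "weak_compositions A m \<subseteq> {b. \<forall>t. (t \<in> A \<longrightarrow> b t \<in> {..m}) \<and> (t \<notin> A \<longrightarrow> b t = 0)}"
    using weak_compositions_le[OF assms] by (auto simp: weak_compositions_def)
qed (intro finite_set_of_finite_funs assms finite_atMost)

lemma sum_weak_compositions_insert:
  fixes h :: "('i \<Rightarrow> nat) \<Rightarrow> 'b::comm_monoid_add"
  assumes A: "finite A" "s \<notin> A"
  shows "(\<Sum>b\<in>weak_compositions (insert s A) m. h b)
       = (\<Sum>k\<le>m. \<Sum>b\<in>weak_compositions A (m - k). h (b(s := k)))"
proof -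
  have upd: "(\<Sum>t\<in>A. if t = s then k else b t) = sum b A" for k and b :: "'i \<Rightarrow> nat"
    using A by (intro sum.cong) auto
  have "(\<Sum>b\<in>weak_compositions (insert s A) m. h b)
      = (\<Sum>(k, b)\<in>Sigma {..m} (\<lambda>k. weak_compositions A (m - k)). h (b(s := k)))"
    by (rule sum.reindex_bij_witness[where i = "\<lambda>(k, b). b(s := k)" and j = "\<lambda>b. (b s, b(s := 0))"])
      (use A in \<open>auto simp: weak_compositions_def upd fun_upd_def fun_eq_iff split: if_splits
        intro!: arg_cong[where f = h]\<close>)
  also have "\<dots> = (\<Sum>k\<le>m. \<Sum>b\<in>weak_compositions A (m - k). h (b(s := k)))"
    by (rule sum.Sigma[symmetric]) (auto intro: finite_weak_compositions A)
  finally show ?thesis .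
qed

lemma fps_prod_nth_weak_compositions:
  fixes F :: "'i \<Rightarrow> 'b::comm_ring_1 fps"
  assumes "finite A"
  shows "fps_nth (\<Prod>t\<in>A. F t) m = (\<Sum>b\<in>weak_compositions A m. \<Prod>t\<in>A. fps_nth (F t) (b t))"
  using assms
proof (induction A arbitrary: m rule: finite_induct)
  case empty
  then show ?case by (auto simp: weak_compositions_empty)
next
  case (insert s A)
  have upd: "(\<Prod>t\<in>A. fps_nth (F t) (if t = s then k else b t)) = (\<Prod>t\<in>A. fps_nth (F t) (b t))"
    for k and b :: "'i \<Rightarrow> nat"
    using insert.hyps by (intro prod.cong) auto
  show ?case
    using insert.hyps
    by (simp add: fps_mult_nth insert.IH sum_weak_compositions_insert upd sum_distrib_left
        atLeast0AtMost)
qed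

lemma prod_fact_dvd_fact_sum:
  fixes b :: "'i \<Rightarrow> nat"
  assumes "finite A"
  shows "(\<Prod>t\<in>A. fact (b t)) dvd (fact (sum b A) :: nat)"
  using assms
proof (induction A rule: finite_induct)
  case (insert s A)
  have "(\<Prod>t\<in>insert s A. fact (b t)) dvd fact (b s) * (fact (sum b A) :: nat)"
    using insert by simp
  also have "\<dots> dvd fact (b s + sum b A)"
    by (rule fact_fact_dvd_fact)
  finally show ?case
    using insert.hyps by simp
qed simp

text \<open>
  The division is exact, so the coefficients are the multinomial coefficients as natural numbers
  and the theorem holds in every commutative semiring; it is applied to complex numbers and to
  formal power series.
\<close>
theorem multinomial_theorem:
  fixes z :: "'i \<Rightarrow> 'b::comm_semiring_1"
  assumes "finite A"
  shows "(\<Sum>t\<in>A. z t) ^ m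
       = (\<Sum>b\<in>weak_compositions A m.
            of_nat (fact m div (\<Prod>t\<in>A. fact (b t))) * (\<Prod>t\<in>A. z t ^ b t))"
  using assms
proof (induction A arbitrary: m rule: finite_induct)
  case empty
  then show ?case by (auto simp: weak_compositions_empty power_0_left)
next
  case (insert s A)
  have coeff: "(m choose k) * (fact (m - k) div (\<Prod>t\<in>A. fact (b t)))
      = fact m div (\<Prod>t\<in>insert s A. fact ((b(s := k)) t))"
    if "k \<le> m" "b \<in> weak_compositions A (m - k)" for k b
  proof -
    have "(\<Prod>t\<in>A. fact (b t)) dvd (fact (m - k) :: nat)"
      using prod_fact_dvd_fact_sum[OF insert.hyps(1), of b] that
      by (simp add: weak_compositions_def)
    then obtain c :: nat where c: "fact (m - k) = (\<Prod>t\<in>A. fact (b t)) * c" ..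
    have pos: "(\<Prod>t\<in>A. fact (b t)) > (0::nat)"
      by (intro prod_pos) auto
    have upd: "(\<Prod>t\<in>A. fact ((b(s := k)) t)) = (\<Prod>t\<in>A. (fact (b t) :: nat))"
      using insert.hyps by (intro prod.cong) auto
    have "fact m = (fact k * (\<Prod>t\<in>A. fact (b t))) * ((m choose k) * c)"
      using binomial_fact_lemma[OF that(1)] c by (simp add: mult_ac)
    then have "fact m div (fact k * (\<Prod>t\<in>A. fact (b t))) = (m choose k) * c"
      using pos by simp
    then show ?thesis
      using insert.hyps c pos upd by simp
  qed
  have upd: "(\<Prod>t\<in>A. z t ^ (if t = s then k else b t)) = (\<Prod>t\<in>A. z t ^ b t)"
    for k and b :: "'i \<Rightarrow> nat"
    using insert.hyps by (intro prod.cong) auto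
  have "(\<Sum>t\<in>insert s A. z t) ^ m
      = (\<Sum>k\<le>m. of_nat (m choose k) * z s ^ k * (\<Sum>t\<in>A. z t) ^ (m - k))"
    using insert.hyps by (simp add: binomial_ring)
  also have "\<dots> = (\<Sum>k\<le>m. \<Sum>b\<in>weak_compositions A (m - k).
      of_nat ((m choose k) * (fact (m - k) div (\<Prod>t\<in>A. fact (b t)))) *
      (z s ^ k * (\<Prod>t\<in>A. z t ^ b t)))"
    by (simp add: insert.IH sum_distrib_left mult_ac)
  also have "\<dots> = (\<Sum>k\<le>m. \<Sum>b\<in>weak_compositions A (m - k).
      of_nat (fact m div (\<Prod>t\<in>insert s A. fact ((b(s := k)) t))) *
      (\<Prod>t\<in>insert s A. z t ^ (b(s := k)) t))"
    by (intro sum.cong refl arg_cong2[where f = "(*)"] arg_cong[where f = of_nat] coeff)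
      (use insert.hyps upd in auto)
  also have "\<dots> = (\<Sum>b\<in>weak_compositions (insert s A) m.
      of_nat (fact m div (\<Prod>t\<in>insert s A. fact (b t))) * (\<Prod>t\<in>insert s A. z t ^ b t))"
    by (rule sum_weak_compositions_insert[OF insert.hyps, symmetric])
  finally show ?case .
qed

lemma of_nat_fact_div_prod_fact:
  assumes "finite A" "b \<in> weak_compositions A m"
  shows "of_nat (fact m div (\<Prod>t\<in>A. fact (b t))) = (fact m / (\<Prod>t\<in>A. fact (b t)) :: 'b::field_char_0)"
proof -
  have "(\<Prod>t\<in>A. fact (b t)) dvd (fact m :: nat)"
    using prod_fact_dvd_fact_sum[OF assms(1), of b] assms(2) by (simp add: weak_compositions_def)
  then obtain c :: nat where c: "fact m = (\<Prod>t\<in>A. fact (b t)) * c" ..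
  have pos: "(\<Prod>t\<in>A. fact (b t)) > (0::nat)"
    by (intro prod_pos) auto
  have "(fact m :: 'b) = of_nat ((\<Prod>t\<in>A. fact (b t)) * c)"
    unfolding c[symmetric] by simp
  then have "(fact m :: 'b) = (\<Prod>t\<in>A. fact (b t)) * of_nat c"
    by simp
  then show ?thesis
    using c pos assms(1) by simp
qed

section \<open>Maximizing a coefficient of a product of series\<close>

lemma fps_one_plus_const_X_power_nth:
  "fps_nth ((1 + fps_const a * fps_X) ^ m) j = of_nat (m choose j) * (a::'a::comm_ring_1) ^ j"
proof -
  have "(1 + fps_const a * fps_X) ^ m
      = (\<Sum>k\<le>m. of_nat (m choose k) * (fps_const a * fps_X) ^ k)"
    using binomial_ring[of "fps_const a * fps_X" 1 m] by (simp add: add.commute)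
  also have "fps_nth \<dots> j = (\<Sum>k\<le>m. if k = j then of_nat (m choose k) * a ^ k else 0)"
    unfolding fps_sum_nth
    by (intro sum.cong refl)
      (auto simp: power_mult_distrib fps_const_power fps_X_power_nth
        simp flip: fps_of_nat mult.assoc)
  finally show ?thesis
    by (simp add: binomial_eq_0)
qed

text \<open>
  The coefficient of \<open>X\<^sup>m\<close> in \<open>(1 + u X + w X\<^sup>2) ^ m\<close>.  What matters is that all coefficients of
  this polynomial in \<open>u\<close> and \<open>w\<close> are nonnegative.
\<close>
definition central_coeff :: "nat \<Rightarrow> real \<Rightarrow> real \<Rightarrow> real" where
  "central_coeff m u w =
     (\<Sum>k | 2 * k \<le> m. of_nat ((m choose k) * ((m - k) choose (m - 2 * k))) * u ^ (m - 2 * k) * w ^ k)"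

lemma central_coeff_fps:
  "fps_nth ((1 + fps_const u * fps_X + fps_const w * fps_X ^ 2) ^ m) m = central_coeff m u w"
proof -
  have expand: "(1 + fps_const u * fps_X + fps_const w * fps_X ^ 2) ^ m
      = (\<Sum>k\<le>m. fps_const (of_nat (m choose k) * w ^ k) *
          ((1 + fps_const u * fps_X) ^ (m - k) * fps_X ^ (2 * k)))"
  proof -
    have "(1 + fps_const u * fps_X + fps_const w * fps_X ^ 2) ^ m
        = (fps_const w * fps_X ^ 2 + (1 + fps_const u * fps_X)) ^ m"
      by (simp only: add.commute)
    also have "\<dots> = (\<Sum>k\<le>m. of_nat (m choose k) * (fps_const w * fps_X ^ 2) ^ k *
        (1 + fps_const u * fps_X) ^ (m - k))"
      by (rule binomial_ring)
    also have "\<dots> = (\<Sum>k\<le>m. fps_const (of_nat (m choose k) * w ^ k) *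
          ((1 + fps_const u * fps_X) ^ (m - k) * fps_X ^ (2 * k)))"
    proof (intro sum.cong refl)
      fix k
      have "of_nat (m choose k) * (fps_const w * fps_X ^ 2) ^ k
          = fps_const (of_nat (m choose k) * w ^ k) * fps_X ^ (2 * k)"
        by (simp only: power_mult_distrib fps_const_power fps_of_nat[symmetric]
            power_mult[symmetric] mult.assoc[symmetric] fps_const_mult)
      then show "of_nat (m choose k) * (fps_const w * fps_X ^ 2) ^ k *
            (1 + fps_const u * fps_X) ^ (m - k)
          = fps_const (of_nat (m choose k) * w ^ k) *
            ((1 + fps_const u * fps_X) ^ (m - k) * fps_X ^ (2 * k))"
        by (simp only: mult_ac)
    qed
    finally show ?thesis .
  qed
  have "fps_nth (\<Sum>k\<le>m. fps_const (of_nat (m choose k) * w ^ k) *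
          ((1 + fps_const u * fps_X) ^ (m - k) * fps_X ^ (2 * k))) m = (\<Sum>k\<le>m. if 2 * k \<le> m then
        of_nat ((m choose k) * ((m - k) choose (m - 2 * k))) * u ^ (m - 2 * k) * w ^ k else 0)"
    unfolding fps_sum_nth
  proof (intro sum.cong refl)
    fix k
    show "fps_nth (fps_const (of_nat (m choose k) * w ^ k) *
          ((1 + fps_const u * fps_X) ^ (m - k) * fps_X ^ (2 * k))) m
        = (if 2 * k \<le> m then
        of_nat ((m choose k) * ((m - k) choose (m - 2 * k))) * u ^ (m - 2 * k) * w ^ k else 0)"
      unfolding fps_mult_left_const_nth fps_X_power_mult_right_nth fps_one_plus_const_X_power_nth
      by (cases "2 * k \<le> m") (simp_all add: mult_ac)
  qed
  also have "\<dots> = central_coeff m u w"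
  proof -
    have "{k. 2 * k \<le> m} = {k \<in> {..m}. 2 * k \<le> m}" by auto
    then show ?thesis
      by (simp only: central_coeff_def sum.inter_filter finite_atMost)
  qed
  finally show ?thesis
    unfolding expand .
qed

lemma finite_half: "finite {k. 2 * k \<le> (m::nat)}"
  by (rule finite_subset[of _ "{..m}"]) auto

lemma central_coeff_mono:
  assumes "0 \<le> u" "0 \<le> w" "w \<le> w'"
  shows "central_coeff m u w \<le> central_coeff m u w'"
  unfolding central_coeff_def
  by (intro sum_mono mult_left_mono power_mono mult_nonneg_nonneg) (use assms in auto)

text \<open>Strictness comes from the summand \<open>k = 1\<close>, which is present because \<open>m \<ge> 2\<close>.\<close>
lemma central_coeff_strict_mono:
  assumes "0 < u" "0 \<le> w" "w < w'" "2 \<le> m"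
  shows "central_coeff m u w < central_coeff m u w'"
  unfolding central_coeff_def
proof (rule sum_strict_mono_ex1[OF finite_half])
  show "\<forall>k\<in>{k. 2 * k \<le> m}.
      real ((m choose k) * ((m - k) choose (m - 2 * k))) * u ^ (m - 2 * k) * w ^ k
    \<le> real ((m choose k) * ((m - k) choose (m - 2 * k))) * u ^ (m - 2 * k) * w' ^ k"
    by (intro ballI mult_left_mono power_mono mult_nonneg_nonneg) (use assms in auto)
  show "\<exists>k\<in>{k. 2 * k \<le> m}.
      real ((m choose k) * ((m - k) choose (m - 2 * k))) * u ^ (m - 2 * k) * w ^ k
    < real ((m choose k) * ((m - k) choose (m - 2 * k))) * u ^ (m - 2 * k) * w' ^ k"
    by (rule bexI[of _ 1]) (use assms in \<open>auto intro!: mult_strict_left_mono mult_pos_pos\<close>)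
qed

text \<open>
  The series \<open>\<Sum>k. (a X) ^ k / k!\<^sup>2\<close>, that is, the modified Bessel function \<open>I\<^sub>0\<close> at \<open>2 \<surd>(a X)\<close>.
\<close>
definition bessel_fps :: "real \<Rightarrow> real fps" where
  "bessel_fps a = Abs_fps (\<lambda>k. a ^ k / (fact k)\<^sup>2)"

lemma bessel_fps_nth: "fps_nth (bessel_fps a) k = a ^ k / (fact k)\<^sup>2"
  by (simp add: bessel_fps_def)

lemma bessel_fps_mult_nth:
  "fps_nth (bessel_fps a * bessel_fps b) m = central_coeff m (a + b) (a * b) / (fact m)\<^sup>2"
proof -
  have "(1 + fps_const a * fps_X) ^ m * (1 + fps_const b * fps_X) ^ m
      = (1 + fps_const (a + b) * fps_X + fps_const (a * b) * fps_X ^ 2) ^ m"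
    by (simp add: algebra_simps power2_eq_square flip: power_mult_distrib fps_const_add fps_const_mult)
  then have "central_coeff m (a + b) (a * b)
      = fps_nth ((1 + fps_const a * fps_X) ^ m * (1 + fps_const b * fps_X) ^ m) m"
    by (simp only: central_coeff_fps[symmetric])
  also have "\<dots> = (\<Sum>j=0..m. (of_nat (m choose j) * a ^ j) * (of_nat (m choose j) * b ^ (m - j)))"
    unfolding fps_mult_nth
  proof (intro sum.cong refl)
    fix j assume "j \<in> {0..m}"
    then have "m choose (m - j) = m choose j"
      using binomial_symmetric[of j m] by simp
    then show "fps_nth ((1 + fps_const a * fps_X) ^ m) j * fps_nth ((1 + fps_const b * fps_X) ^ m) (m - j)
        = (of_nat (m choose j) * a ^ j) * (of_nat (m choose j) * b ^ (m - j))"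
      by (simp add: fps_one_plus_const_X_power_nth)
  qed
  also have "\<dots> = (fact m)\<^sup>2 * fps_nth (bessel_fps a * bessel_fps b) m"
    unfolding fps_mult_nth sum_distrib_left
    by (intro sum.cong refl)
      (simp add: bessel_fps_nth binomial_fact power2_eq_square divide_simps)
  finally show ?thesis by (simp add: divide_simps)
qed

lemma fps_mult_nth_nonneg:
  fixes F G :: "real fps"
  assumes "\<And>k. fps_nth F k \<ge> 0" "\<And>k. fps_nth G k \<ge> 0"
  shows "fps_nth (F * G) m \<ge> 0"
  unfolding fps_mult_nth by (intro sum_nonneg mult_nonneg_nonneg assms)

lemma prod_bessel_fps_nth_nonneg:
  assumes "\<And>t. t \<in> A \<Longrightarrow> 0 \<le> a t"
  shows "0 \<le> fps_nth (\<Prod>t\<in>A. bessel_fps (a t)) m"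
  using assms
proof (induction A arbitrary: m rule: infinite_finite_induct)
  case (insert s A)
  then show ?case
    by (auto intro!: fps_mult_nth_nonneg simp: bessel_fps_nth)
qed auto

lemma prod_bessel_fps_nth_0: "fps_nth (\<Prod>t\<in>A. bessel_fps (a t)) 0 = 1"
  by (induction A rule: infinite_finite_induct) (auto simp: bessel_fps_nth)

text \<open>
  Changing two entries so that their sum is kept and their product grows increases the
  coefficient.  The remaining factors have nonnegative coefficients and constant term \<open>1\<close>, so the
  strict increase in degree \<open>d\<close> of the two changed factors survives.
\<close>
lemma prod_bessel_fps_smoothing:
  assumes A: "finite A" "s \<in> A" "t \<in> A" "s \<noteq> t"
    and nonneg: "\<And>i. i \<in> A \<Longrightarrow> 0 \<le> a i" "0 \<le> u" "0 \<le> v"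
    and sum_eq: "u + v = a s + a t" and prod_less: "a s * a t < u * v" and "2 \<le> d"
  shows "fps_nth (\<Prod>i\<in>A. bessel_fps (a i)) d
       < fps_nth (\<Prod>i\<in>A. bessel_fps ((a(s := u, t := v)) i)) d"
proof -
  define R where "R = (\<Prod>i\<in>A - {s, t}. bessel_fps (a i))"
  have split: "(\<Prod>i\<in>A. bessel_fps (h i)) = bessel_fps (h s) * bessel_fps (h t) * (\<Prod>i\<in>A - {s, t}. bessel_fps (h i))" for h
  proof -
    have "A = insert s (insert t (A - {s, t}))" using A by auto
    then have "(\<Prod>i\<in>A. bessel_fps (h i)) = (\<Prod>i\<in>insert s (insert t (A - {s, t})). bessel_fps (h i))"
      by simp
    also have "\<dots> = bessel_fps (h s) * bessel_fps (h t) * (\<Prod>i\<in>A - {s, t}. bessel_fps (h i))"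
      using A by (subst prod.insert) (auto simp: mult.assoc)
    finally show ?thesis .
  qed
  have R': "(\<Prod>i\<in>A - {s, t}. bessel_fps ((a(s := u, t := v)) i)) = R"
    unfolding R_def by (intro prod.cong) auto
  have st: "0 \<le> a s" "0 \<le> a t" "0 \<le> a s * a t" using nonneg A by auto
  have "0 < u * v" using st prod_less by linarith
  then have "0 < u + v" using nonneg by (auto simp: zero_less_mult_iff)
  have Rnn: "0 \<le> fps_nth R k" for k
    unfolding R_def by (intro prod_bessel_fps_nth_nonneg nonneg) auto
  have "fps_nth (bessel_fps (a s) * bessel_fps (a t) * R) d
      < fps_nth (bessel_fps u * bessel_fps v * R) d"
    unfolding fps_mult_nth[of _ R]
  proof (rule sum_strict_mono_ex1)
    show "\<forall>k\<in>{0..d}. fps_nth (bessel_fps (a s) * bessel_fps (a t)) k * fps_nth R (d - k)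
        \<le> fps_nth (bessel_fps u * bessel_fps v) k * fps_nth R (d - k)"
      unfolding bessel_fps_mult_nth sum_eq
      by (intro ballI mult_right_mono divide_right_mono central_coeff_mono Rnn)
        (use st prod_less in auto)
    show "\<exists>k\<in>{0..d}. fps_nth (bessel_fps (a s) * bessel_fps (a t)) k * fps_nth R (d - k)
        < fps_nth (bessel_fps u * bessel_fps v) k * fps_nth R (d - k)"
    proof (rule bexI[of _ d])
      have "central_coeff d (a s + a t) (a s * a t) < central_coeff d (u + v) (u * v)"
        unfolding sum_eq
        by (rule central_coeff_strict_mono) (use st prod_less \<open>0 < u + v\<close> sum_eq \<open>2 \<le> d\<close> in auto)
      then show "fps_nth (bessel_fps (a s) * bessel_fps (a t)) d * fps_nth R (d - d)
        < fps_nth (bessel_fps u * bessel_fps v) d * fps_nth R (d - d)"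
        unfolding bessel_fps_mult_nth
        by (simp add: R_def prod_bessel_fps_nth_0 divide_strict_right_mono)
    qed auto
  qed auto
  then show ?thesis
    using split[of a] split[of "a(s := u, t := v)"] R' A by (simp add: R_def)
qed

text \<open>
  Induction on the number of entries that differ from the mean \<open>\<mu>\<close>: each step moves one entry below
  the mean onto \<open>\<mu>\<close> and compensates with an entry above the mean.
\<close>
lemma prod_bessel_fps_less_mean:
  assumes A: "finite A" and nonneg: "\<And>t. t \<in> A \<Longrightarrow> 0 \<le> a t"
    and mean: "sum a A = of_nat (card A) * \<mu>" and "2 \<le> d" and "\<exists>t\<in>A. a t \<noteq> \<mu>"
  shows "fps_nth (\<Prod>t\<in>A. bessel_fps (a t)) d < fps_nth (\<Prod>t\<in>A. bessel_fps \<mu>) d"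
  using nonneg mean \<open>\<exists>t\<in>A. a t \<noteq> \<mu>\<close>
proof (induction "card {t \<in> A. a t \<noteq> \<mu>}" arbitrary: a rule: less_induct)
  case less
  have sum_mean: "sum a A = (\<Sum>t\<in>A. \<mu>)" using less.prems(2) by simp
  obtain r where r: "r \<in> A" "a r \<noteq> \<mu>" using less.prems(3) by blast
  have "\<exists>s\<in>A. a s < \<mu>"
  proof (rule ccontr)
    assume *: "\<not> ?thesis"
    have "(\<Sum>t\<in>A. \<mu>) < sum a A"
      by (rule sum_strict_mono_ex1[OF A]) (use * r in \<open>force simp: not_less\<close>)+
    with sum_mean show False by simp
  qed
  then obtain s where s: "s \<in> A" "a s < \<mu>" by blast
  have "\<exists>t\<in>A. \<mu> < a t"
  proof (rule ccontr)
    assume *: "\<not> ?thesis"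
    have "sum a A < (\<Sum>t\<in>A. \<mu>)"
      by (rule sum_strict_mono_ex1[OF A]) (use * r in \<open>force simp: not_less\<close>)+
    with sum_mean show False by simp
  qed
  then obtain t where t: "t \<in> A" "\<mu> < a t" by blast
  define v where "v = a s + a t - \<mu>"
  define a' where "a' = a(s := \<mu>, t := v)"
  have "s \<noteq> t" using s t by auto
  have nn: "0 \<le> \<mu>" "0 \<le> v" using s t less.prems(1)[of s] by (auto simp: v_def)
  have "(\<mu> - a s) * (a t - \<mu>) > 0" using s t by simp
  then have prod_less: "a s * a t < \<mu> * v" by (simp add: v_def algebra_simps)
  have step: "fps_nth (\<Prod>i\<in>A. bessel_fps (a i)) d < fps_nth (\<Prod>i\<in>A. bessel_fps (a' i)) d"
    unfolding a'_def
    by (rule prod_bessel_fps_smoothing)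
      (use A s t \<open>s \<noteq> t\<close> nn less.prems(1) prod_less \<open>2 \<le> d\<close> in \<open>auto simp: v_def\<close>)
  show ?case
  proof (cases "\<exists>i\<in>A. a' i \<noteq> \<mu>")
    case True
    have "{i \<in> A. a' i \<noteq> \<mu>} \<subseteq> {i \<in> A. a i \<noteq> \<mu>} - {s}"
    proof
      fix i assume "i \<in> {i \<in> A. a' i \<noteq> \<mu>}"
      then show "i \<in> {i \<in> A. a i \<noteq> \<mu>} - {s}"
        using t \<open>s \<noteq> t\<close> by (cases "i = t"; cases "i = s") (auto simp: a'_def)
    qed
    moreover have "s \<in> {i \<in> A. a i \<noteq> \<mu>}"
      using s by auto
    ultimately have "{i \<in> A. a' i \<noteq> \<mu>} \<subset> {i \<in> A. a i \<noteq> \<mu>}"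
      by blast
    then have "card {i \<in> A. a' i \<noteq> \<mu>} < card {i \<in> A. a i \<noteq> \<mu>}"
      using A by (intro psubset_card_mono) auto
    moreover have "sum a' A = of_nat (card A) * \<mu>"
    proof -
      have "sum h A = h s + h t + sum h (A - {s, t})" for h :: "'a \<Rightarrow> real"
      proof -
        have "sum h A = h s + sum h (A - {s})"
          using A s by (intro sum.remove) auto
        also have "sum h (A - {s}) = h t + sum h (A - {s} - {t})"
          using A t \<open>s \<noteq> t\<close> by (intro sum.remove) auto
        also have "A - {s} - {t} = A - {s, t}"
          by blast
        finally show ?thesis by simp
      qed
      moreover have "sum a' (A - {s, t}) = sum a (A - {s, t})"
        by (intro sum.cong) (auto simp: a'_def)
      ultimately show ?thesis
        using less.prems(2) \<open>s \<noteq> t\<close> by (simp add: a'_def v_def)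
    qed
    ultimately have "fps_nth (\<Prod>i\<in>A. bessel_fps (a' i)) d < fps_nth (\<Prod>t\<in>A. bessel_fps \<mu>) d"
      by (intro less.hyps True) (use less.prems(1) nn in \<open>auto simp: a'_def\<close>)
    with step show ?thesis by simp
  next
    case False
    then have "(\<Prod>i\<in>A. bessel_fps (a' i)) = (\<Prod>t\<in>A. bessel_fps \<mu>)"
      by (intro prod.cong) auto
    with step show ?thesis by simp
  qed
qed

lemma prod_bessel_fps_nth_expand:
  assumes "finite A"
  shows "(fact m)\<^sup>2 * fps_nth (\<Prod>t\<in>A. bessel_fps (a t)) m
       = (\<Sum>b\<in>weak_compositions A m. (fact m / (\<Prod>t\<in>A. fact (b t)))\<^sup>2 * (\<Prod>t\<in>A. a t ^ b t))"
  unfolding fps_prod_nth_weak_compositions[OF assms] sum_distrib_left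
  by (intro sum.cong refl)
    (simp add: bessel_fps_nth prod_dividef power_divide prod_power_distrib)

lemma prod_bessel_fps_const_nth:
  assumes "finite A"
  shows "fps_nth (\<Prod>t\<in>A. bessel_fps \<mu>) m = \<mu> ^ m * fps_nth (\<Prod>t\<in>A. bessel_fps 1) m"
proof -
  have "(fact m)\<^sup>2 * fps_nth (\<Prod>t\<in>A. bessel_fps \<mu>) m
      = \<mu> ^ m * ((fact m)\<^sup>2 * fps_nth (\<Prod>t\<in>A. bessel_fps 1) m)"
    unfolding prod_bessel_fps_nth_expand[OF assms] sum_distrib_left
    by (intro sum.cong refl) (auto simp: weak_compositions_def simp flip: power_sum)
  then show ?thesis by simp
qed

section \<open>The additive character of a finite field\<close>

lemma of_nat_CARD_eq_0: "of_nat CARD('a) = (0 :: 'a::{finite, ring_1})"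
proof -
  have "(\<Sum>x\<in>UNIV. x + (1::'a)) = (\<Sum>x\<in>UNIV. x)"
    by (rule sum.reindex_bij_witness[of _ "\<lambda>x. x - 1" "\<lambda>x. x + 1"]) auto
  then show ?thesis
    by (simp add: sum.distrib)
qed

lemma CHAR_finite_field_eq:
  assumes "prime p" "CARD('a::{finite, field}) = p ^ n"
  shows "CHAR('a) = p"
proof -
  have "CHAR('a) > 0"
    by (rule finite_imp_CHAR_pos) simp
  then have "prime CHAR('a)"
    by (rule prime_CHAR_semidom)
  moreover have "CHAR('a) dvd p ^ n"
    using of_nat_CARD_eq_0[where 'a = 'a] assms(2) of_nat_eq_0_iff_char_dvd[where 'a = 'a, of "p ^ n"]
    by metis
  ultimately show ?thesis
    using assms(1) by (meson prime_dvd_power primes_dvd_imp_eq)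
qed

lemma power_CARD_eq_self:
  fixes x :: "'a::{finite, field}"
  shows "x ^ CARD('a) = x"
proof (cases "x = 0")
  case False
  have "(\<Prod>y\<in>UNIV - {0}. y) = (\<Prod>y\<in>UNIV - {0}. x * y)"
    by (rule prod.reindex_bij_witness[of _ "\<lambda>y. x * y" "\<lambda>y. y / x"]) (use False in auto)
  also have "\<dots> = x ^ (CARD('a) - 1) * (\<Prod>y\<in>UNIV - {0}. y)"
    by (simp add: prod.distrib)
  finally have "x ^ (CARD('a) - 1) = 1"
    by simp
  then show ?thesis
    using power_minus_mult[of "CARD('a)" x] by simp
qed (simp add: zero_less_card_finite)

text \<open>
  A finite field with \<open>p ^ n\<close> elements; the type argument only fixes the field.
\<close>
locale finite_field_character =
  fixes p n :: nat and ty :: "'a::{finite, field} itself"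
  assumes prime_p: "prime p" and n_pos: "n \<ge> 1" and CARD_eq: "CARD('a) = p ^ n"
begin

lemma CHAR_eq: "CHAR('a) = p"
  by (rule CHAR_finite_field_eq[OF prime_p CARD_eq])

lemma prime_CHAR: "prime CHAR('a)"
  by (simp add: CHAR_eq prime_p)

lemma p_gt_0: "p > 0"
  using prime_p prime_gt_0_nat by blast

lemma of_nat_eq_iff_mod: "(of_nat k = (of_nat l :: 'a)) \<longleftrightarrow> k mod p = l mod p"
proof (induction k l rule: linorder_wlog)
  case (le k l)
  have "of_nat k = (of_nat l :: 'a) \<longleftrightarrow> of_nat (l - k) = (0 :: 'a)"
    using le by (auto simp: of_nat_diff)
  also have "\<dots> \<longleftrightarrow> p dvd l - k"
    by (simp add: of_nat_eq_0_iff_char_dvd CHAR_eq)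
  also have "\<dots> \<longleftrightarrow> k mod p = l mod p"
    using le mod_eq_dvd_iff_nat[of k l p] by auto
  finally show ?case .
qed auto

lemma of_nat_power_p: "of_nat k ^ p = (of_nat k :: 'a)"
proof (induction k)
  case (Suc k)
  then show ?case
    using freshmans_dream[OF prime_CHAR CHAR_eq[symmetric], of 1 "of_nat k :: 'a"] by simp
qed (use p_gt_0 in simp)

text \<open>
  The \<open>p\<close> elements \<open>of_nat k\<close> with \<open>k < p\<close> already exhaust the roots of \<open>X\<^sup>p - X\<close>.
\<close>
lemma frobenius_fixed_imp_of_nat:
  assumes "z ^ p = (z :: 'a)"
  obtains k where "k < p" "of_nat k = z"
proof -
  define P :: "'a poly" where "P = monom 1 p - monom 1 1"
  have p1: "p > 1" using prime_p prime_gt_1_nat by blast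
  then have "coeff P p = 1" by (simp add: P_def)
  then have "P \<noteq> 0" by auto
  moreover have "degree P \<le> p"
    unfolding P_def using p1 by (intro degree_diff_le) (auto simp: degree_monom_eq)
  ultimately have roots: "card {x. poly P x = 0} \<le> p"
    using card_poly_roots_bound[of P] by linarith
  have "inj_on (of_nat :: nat \<Rightarrow> 'a) {..<p}"
    by (auto simp: inj_on_def of_nat_eq_iff_mod)
  then have "card ((of_nat :: nat \<Rightarrow> 'a) ` {..<p}) = p"
    by (simp add: card_image)
  moreover have sub: "(of_nat :: nat \<Rightarrow> 'a) ` {..<p} \<subseteq> {x. poly P x = 0}"
    by (auto simp: P_def poly_monom of_nat_power_p)
  ultimately have "(of_nat :: nat \<Rightarrow> 'a) ` {..<p} = {x. poly P x = 0}"
    using roots by (intro card_seteq) auto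
  moreover have "z \<in> {x. poly P x = 0}"
    using assms by (simp add: P_def poly_monom)
  ultimately have "z \<in> (of_nat :: nat \<Rightarrow> 'a) ` {..<p}"
    by blast
  then show ?thesis using that by auto
qed

lemma field_trace_power_p: "field_trace p n y ^ p = (field_trace p n y :: 'a)"
proof -
  have "field_trace p n y ^ p = (\<Sum>k<n. y ^ p ^ Suc k)"
    unfolding field_trace_def freshmans_dream_sum[OF prime_CHAR CHAR_eq[symmetric]]
    by (simp add: mult.commute flip: power_mult)
  moreover have "(\<Sum>k<n. y ^ p ^ Suc k) + y ^ p ^ 0 = (\<Sum>k<n. y ^ p ^ k) + y ^ p ^ n"
    using sum.lessThan_Suc[of "\<lambda>k. y ^ p ^ k" n] sum.lessThan_Suc_shift[of "\<lambda>k. y ^ p ^ k" n]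
    by (simp add: add.commute)
  moreover have "y ^ p ^ n = y"
    using power_CARD_eq_self[of y] CARD_eq by simp
  ultimately show ?thesis by (simp add: field_trace_def)
qed

lemma field_trace_add: "field_trace p n (x + y) = field_trace p n x + (field_trace p n y :: 'a)"
  unfolding field_trace_def sum.distrib[symmetric]
  by (intro sum.cong refl freshmans_dream'[OF prime_CHAR]) (simp add: CHAR_eq)

text \<open>
  The trace is given by a nonzero polynomial of degree less than the size of the field.
\<close>
lemma field_trace_nonzero: "\<exists>y::'a. field_trace p n y \<noteq> 0"
proof (rule ccontr)
  assume trace_0: "\<not> ?thesis"
  define P :: "'a poly" where "P = (\<Sum>k<n. monom 1 (p ^ k))"
  have p1: "p > 1" using prime_p prime_gt_1_nat by blast
  have "coeff P 1 = (\<Sum>k<n. if k = 0 then 1 else 0)"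
    unfolding P_def coeff_sum by (intro sum.cong) (use p1 in auto)
  then have "coeff P 1 = 1" using n_pos by simp
  then have "P \<noteq> 0" by auto
  have "degree P \<le> p ^ (n - 1)"
    unfolding P_def
    by (intro degree_sum_le) (use p1 in \<open>auto simp: degree_monom_eq intro!: power_increasing\<close>)
  moreover have "card {x. poly P x = 0} = p ^ n"
    using trace_0 CARD_eq by (simp add: P_def poly_sum poly_monom field_trace_def)
  moreover have "p ^ (n - 1) < p ^ n"
    using p1 n_pos by (intro power_strict_increasing) auto
  ultimately show False
    using card_poly_roots_bound[OF \<open>P \<noteq> 0\<close>] by linarith
qed

text \<open>A primitive \<open>p\<close>-th root of unity.\<close>
definition \<omega> :: complex where "\<omega> = cis (2 * pi / real p)"

lemma omega_power_p: "\<omega> ^ p = 1"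
  using p_gt_0 by (simp add: \<omega>_def Complex.DeMoivre)

lemma omega_power_mod: "\<omega> ^ (k mod p) = \<omega> ^ k"
proof -
  have "\<omega> ^ k = \<omega> ^ (p * (k div p) + k mod p)" by simp
  also have "\<dots> = \<omega> ^ (k mod p)"
    unfolding power_add power_mult omega_power_p by simp
  finally show ?thesis ..
qed

lemma omega_power_eq_1D:
  assumes "\<omega> ^ k = 1"
  shows "p dvd k"
proof -
  have "cos (real k * (2 * pi / real p)) = 1"
    using assms by (simp add: \<omega>_def Complex.DeMoivre complex_eq_iff)
  then obtain m :: int where "real k * (2 * pi / real p) = of_int m * 2 * pi"
    by (auto simp: cos_one_2pi_int)
  then have "real k = of_int m * real p"
    using p_gt_0 by (simp add: field_simps)
  then have "of_int (int k) = (of_int (m * int p) :: real)" by simp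
  then have "int k = m * int p" by (simp only: of_int_eq_iff)
  then show ?thesis by (metis dvd_triv_right int_dvd_int_iff)
qed

text \<open>
  Any natural number that represents the trace may be used as the exponent, not only the one
  below \<open>p\<close>.
\<close>
lemma add_char_eq:
  assumes "of_nat k = (field_trace p n y :: 'a)"
  shows "add_char p n y = \<omega> ^ k"
proof -
  have "prime_field_rep p (field_trace p n y) = k mod p"
    unfolding prime_field_rep_def assms[symmetric] of_nat_eq_iff_mod
    by (rule the_equality) (use p_gt_0 in auto)
  then have "add_char p n y = exp (2 * of_real pi * \<i> * of_nat (k mod p) / of_nat p)"
    by (simp add: add_char_def)
  also have "\<dots> = cis (real (k mod p) * (2 * pi / real p))"
    by (simp add: cis_conv_exp mult_ac)
  also have "\<dots> = \<omega> ^ k"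
    by (simp only: \<omega>_def[symmetric] Complex.DeMoivre[symmetric] omega_power_mod)
  finally show ?thesis .
qed

lemma obtain_trace_rep:
  obtains k where "of_nat k = (field_trace p n y :: 'a)" "k < p"
  using frobenius_fixed_imp_of_nat[OF field_trace_power_p[of y]] by metis

lemma add_char_add: "add_char p n (x + y :: 'a) = add_char p n x * add_char p n y"
proof -
  obtain k where k: "of_nat k = (field_trace p n x :: 'a)" by (rule obtain_trace_rep)
  obtain l where l: "of_nat l = (field_trace p n y :: 'a)" by (rule obtain_trace_rep)
  have "of_nat (k + l) = (field_trace p n (x + y) :: 'a)"
    by (simp add: k l field_trace_add)
  then show ?thesis
    by (simp only: add_char_eq[OF k] add_char_eq[OF l] add_char_eq[of "k + l"] power_add)
qed

lemma add_char_0: "add_char p n (0 :: 'a) = 1"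
  using add_char_eq[of 0 0] p_gt_0 by (simp add: field_trace_def power_0_left)

lemma norm_add_char: "cmod (add_char p n (y :: 'a)) = 1"
  by (rule obtain_trace_rep[of y]) (simp add: add_char_eq norm_power \<omega>_def)

lemma cnj_add_char: "cnj (add_char p n (y :: 'a)) = add_char p n (- y)"
proof -
  have "add_char p n y * add_char p n (- y) = 1"
    by (simp add: add_char_add[symmetric] add_char_0)
  moreover have "add_char p n y * cnj (add_char p n y) = 1"
    by (simp add: complex_norm_square[symmetric] norm_add_char)
  ultimately show ?thesis
    by (metis mult_cancel_left mult_zero_left zero_neq_one)
qed

lemma add_char_sum: "add_char p n (\<Sum>i\<in>I. h i :: 'a) = (\<Prod>i\<in>I. add_char p n (h i))"
  by (induction I rule: infinite_finite_induct) (simp_all add: add_char_0 add_char_add)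

lemma add_char_of_nat_mult: "add_char p n (of_nat k * y :: 'a) = add_char p n y ^ k"
  by (induction k) (simp_all add: add_char_0 add_char_add algebra_simps)

lemma add_char_nontrivial: "\<exists>y::'a. add_char p n y \<noteq> 1"
proof -
  obtain y :: 'a where y: "field_trace p n y \<noteq> 0" using field_trace_nonzero by blast
  obtain k where k: "of_nat k = field_trace p n y" "k < p" by (rule obtain_trace_rep)
  have "\<not> p dvd k"
    using k y by (metis gr_zeroI nat_dvd_not_less of_nat_0)
  then show ?thesis
    using omega_power_eq_1D add_char_eq[OF k(1)] by metis
qed

lemma sum_add_char: "(\<Sum>y\<in>UNIV. add_char p n (y * c :: 'a)) = (if c = 0 then of_nat (CARD('a)) else 0)"
proof (cases "c = 0")
  case False
  define S where "S = (\<Sum>y\<in>UNIV. add_char p n (y :: 'a))"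
  have "(\<Sum>y\<in>UNIV. add_char p n (y * c)) = S"
    unfolding S_def
    by (rule sum.reindex_bij_witness[of _ "\<lambda>y. y / c" "\<lambda>y. y * c"]) (use False in auto)
  moreover have "S = 0"
  proof -
    obtain z :: 'a where z: "add_char p n z \<noteq> 1" using add_char_nontrivial by blast
    have "S = (\<Sum>y\<in>UNIV. add_char p n (z + y))"
      unfolding S_def
      by (rule sum.reindex_bij_witness[of _ "\<lambda>y. z + y" "\<lambda>y. y - z"]) auto
    also have "\<dots> = add_char p n z * S"
      by (simp add: S_def add_char_add sum_distrib_left)
    finally show ?thesis using z by simp
  qed
  ultimately show ?thesis using False by simp
qed (simp add: add_char_0)

lemma sum_vectors_add_char:
  "(\<Sum>x\<in>vectors d. add_char p n (dot d x v :: 'a))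
     = (if \<forall>i\<in>{1..d}. v i = 0 then of_nat (CARD('a)) ^ d else 0)"
proof -
  have "(\<Sum>x\<in>vectors d. add_char p n (dot d x v))
      = (\<Prod>i\<in>{1..d}. \<Sum>y\<in>UNIV. add_char p n (y * v i))"
    unfolding vectors_def dot_def add_char_sum by (rule prod_sum_PiE[symmetric]) auto
  also have "\<dots> = (\<Prod>i\<in>{1..d}. if v i = 0 then of_nat (CARD('a)) else 0)"
    by (simp add: sum_add_char)
  also have "\<dots> = (if \<forall>i\<in>{1..d}. v i = 0 then of_nat (CARD('a)) ^ d else 0)"
  proof (cases "\<forall>i\<in>{1..d}. v i = 0")
    case False
    then show ?thesis by (auto intro!: prod_zero)
  qed simp
  finally show ?thesis .
qed

end

section \<open>Power sums determine multiplicities\<close>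

text \<open>
  The logarithmic derivative \<open>- t / (1 - t X)\<close> of \<open>1 - t X\<close>.
\<close>
definition power_sum_series :: "'a::field \<Rightarrow> 'a fps" where
  "power_sum_series t = Abs_fps (\<lambda>k. - (t ^ Suc k))"

lemma fps_deriv_linear_factor:
  "fps_deriv (1 - fps_const t * fps_X) = power_sum_series t * (1 - fps_const t * fps_X)"
proof (rule fps_ext)
  fix k
  show "fps_nth (fps_deriv (1 - fps_const t * fps_X)) k
      = fps_nth (power_sum_series t * (1 - fps_const t * fps_X)) k"
    by (cases k) (simp_all add: power_sum_series_def algebra_simps)
qed

lemma fps_deriv_log_mult:
  fixes F G :: "'a::comm_ring_1 fps"
  assumes "fps_deriv F = L * F" "fps_deriv G = M * G"
  shows "fps_deriv (F * G) = (L + M) * (F * G)"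
  using assms by (simp add: algebra_simps)

lemma fps_deriv_log_power:
  fixes F :: "'a::comm_ring_1 fps"
  assumes "fps_deriv F = L * F"
  shows "fps_deriv (F ^ m) = (of_nat m * L) * F ^ m"
proof (induction m)
  case (Suc m)
  show ?case
    using fps_deriv_log_mult[OF assms Suc] by (simp add: algebra_simps)
qed simp

lemma fps_deriv_log_prod:
  fixes F :: "'i \<Rightarrow> 'a::comm_ring_1 fps"
  assumes "\<And>t. t \<in> A \<Longrightarrow> fps_deriv (F t) = L t * F t"
  shows "fps_deriv (\<Prod>t\<in>A. F t) = (\<Sum>t\<in>A. L t) * (\<Prod>t\<in>A. F t)"
  using assms
proof (induction A rule: infinite_finite_induct)
  case (insert s A)
  have "fps_deriv (F s * prod F A) = (L s + sum L A) * (F s * prod F A)"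
    using insert by (intro fps_deriv_log_mult) auto
  then show ?case using insert by simp
qed auto

text \<open>
  The reciprocal polynomial \<open>\<Prod>t\<in>A. (1 - t X) ^ b t\<close>, as a power series.  Its logarithmic
  derivative has the power sums of \<open>b\<close>, up to sign, as coefficients.
\<close>
definition root_fps :: "'a::field set \<Rightarrow> ('a \<Rightarrow> nat) \<Rightarrow> 'a fps" where
  "root_fps A b = (\<Prod>t\<in>A. (1 - fps_const t * fps_X) ^ b t)"

text \<open>Newton's identities.\<close>
lemma root_fps_nth_Suc:
  "of_nat (Suc k) * fps_nth (root_fps A b) (Suc k)
     = - (\<Sum>i=0..k. (\<Sum>t\<in>A. of_nat (b t) * t ^ Suc i) * fps_nth (root_fps A b) (k - i))"
proof -
  define L where "L = (\<Sum>t\<in>A. of_nat (b t) * power_sum_series t)"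
  have "fps_deriv (root_fps A b) = L * root_fps A b"
    unfolding root_fps_def L_def
    by (intro fps_deriv_log_prod fps_deriv_log_power fps_deriv_linear_factor)
  moreover have "fps_nth (fps_deriv (root_fps A b)) k = of_nat (Suc k) * fps_nth (root_fps A b) (Suc k)"
    by simp
  ultimately have "of_nat (Suc k) * fps_nth (root_fps A b) (Suc k)
      = (\<Sum>i=0..k. fps_nth L i * fps_nth (root_fps A b) (k - i))"
    by (simp only: fps_mult_nth)
  moreover have "fps_nth L i = - (\<Sum>t\<in>A. of_nat (b t) * t ^ Suc i)" for i
    unfolding L_def fps_sum_nth sum_negf[symmetric]
    by (intro sum.cong refl) (simp add: power_sum_series_def flip: fps_of_nat)
  ultimately show ?thesis by (simp add: sum_negf)
qed

lemma root_fps_nth_eq: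
  fixes A :: "'a::field set"
  assumes char: "\<And>k. 0 < k \<Longrightarrow> k \<le> d \<Longrightarrow> of_nat k \<noteq> (0 :: 'a)"
    and eq: "\<And>j. j \<in> {1..d} \<Longrightarrow> (\<Sum>t\<in>A. of_nat (b t) * t ^ j) = (\<Sum>t\<in>A. of_nat (b' t) * t ^ j)"
    and "k \<le> d"
  shows "fps_nth (root_fps A b) k = fps_nth (root_fps A b') k"
  using \<open>k \<le> d\<close>
proof (induction k rule: less_induct)
  case (less k)
  show ?case
  proof (cases k)
    case 0
    have "fps_nth (root_fps A c) 0 = 1" for c
      unfolding root_fps_def by (induction A rule: infinite_finite_induct) (auto simp: fps_power_zeroth)
    then show ?thesis by (simp add: 0)
  next
    case (Suc m)
    have "of_nat (Suc m) * fps_nth (root_fps A b) (Suc m)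
        = of_nat (Suc m) * fps_nth (root_fps A b') (Suc m)"
      unfolding root_fps_nth_Suc
      by (intro arg_cong[where f = uminus] sum.cong refl arg_cong2[where f = "(*)"] eq less.IH)
        (use Suc less.prems in auto)
    moreover have "of_nat (Suc m) \<noteq> (0 :: 'a)"
      using char[of "Suc m"] Suc less.prems by blast
    ultimately show ?thesis
      using Suc by (metis mult_left_cancel)
  qed
qed

lemma order_prod:
  fixes f :: "'i \<Rightarrow> 'a::idom poly"
  assumes "finite A" "\<And>t. t \<in> A \<Longrightarrow> f t \<noteq> 0"
  shows "order x (\<Prod>t\<in>A. f t) = (\<Sum>t\<in>A. order x (f t))"
  using assms
proof (induction A rule: finite_induct)
  case (insert s A)
  have "f s * prod f A \<noteq> 0"
    using insert by (auto simp: prod_zero_iff)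
  then show ?case
    using insert by (simp add: order_mult)
qed simp

lemma order_linear_factor_power:
  fixes s :: "'a::field"
  assumes "s \<noteq> 0"
  shows "order (inverse s) ([:1, - t:] ^ m) = (if t = s then m else 0)"
proof (cases "t = s")
  case True
  have "[:1, - s:] = smult (- s) [:- inverse s, 1:]"
    using assms by simp
  then have "[:1, - s:] ^ m = smult ((- s) ^ m) ([:- inverse s, 1:] ^ m)"
    by (simp only: smult_power)
  then show ?thesis
    using True assms by (simp only: order_smult order_power_n_n power_not_zero neg_equal_0_iff_equal simp_thms if_True)
next
  case False
  have "poly ([:1, - t:] ^ m) (inverse s) \<noteq> 0"
    using False assms by (simp add: field_simps)
  then show ?thesis
    using False by (simp add: order_0I)
qed

text \<open>
  Newton's identities recover the first \<open>d\<close> coefficients of \<open>\<Prod>t\<in>A. (1 - t X) ^ b t\<close> from the power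
  sums, and this polynomial has degree at most \<open>d\<close>.  For \<open>s \<noteq> 0\<close>, the multiplicity \<open>b s\<close> is the
  order of its root \<open>1 / s\<close>.  The factor for \<open>t = 0\<close> is trivial, so \<open>b 0\<close> is read off from the
  total mass.
\<close>
theorem power_sums_determine_multiplicities:
  fixes A :: "'a::field set"
  assumes A: "finite A"
    and char: "\<And>k. 0 < k \<Longrightarrow> k \<le> d \<Longrightarrow> of_nat k \<noteq> (0 :: 'a)"
    and b: "b \<in> weak_compositions A d" and b': "b' \<in> weak_compositions A d"
    and eq: "\<And>j. j \<in> {1..d} \<Longrightarrow> (\<Sum>t\<in>A. of_nat (b t) * t ^ j) = (\<Sum>t\<in>A. of_nat (b' t) * t ^ j)"
  shows "b = b'"
proof -
  define Q :: "('a \<Rightarrow> nat) \<Rightarrow> 'a poly" where "Q c = (\<Prod>t\<in>A. [:1, - t:] ^ c t)" for c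
  have fps: "fps_of_poly (Q c) = root_fps A c" for c
    by (simp add: Q_def root_fps_def fps_of_poly_prod fps_of_poly_power fps_of_poly_pCons mult.commute
        flip: fps_const_neg)
  have deg: "degree (Q c) \<le> d" if "c \<in> weak_compositions A d" for c
  proof -
    have "degree (Q c) \<le> (\<Sum>t\<in>A. degree ([:1, - t:] ^ c t))"
      unfolding Q_def using degree_prod_sum_le[OF A] by (simp add: o_def)
    also have "\<dots> \<le> (\<Sum>t\<in>A. c t)"
    proof (rule sum_mono)
      fix t
      have "degree ([:1, - t:] ^ c t) \<le> degree [:1, - t:] * c t"
        by (rule degree_power_le)
      also have "\<dots> \<le> 1 * c t"
        by (intro mult_right_mono) auto
      finally show "degree ([:1, - t:] ^ c t) \<le> c t" by simp
    qed
    also have "\<dots> = d" using that by (simp add: weak_compositions_def)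
    finally show ?thesis .
  qed
  have QQ: "Q b = Q b'"
  proof (rule poly_eqI)
    fix k
    show "coeff (Q b) k = coeff (Q b') k"
    proof (cases "k \<le> d")
      case True
      then show ?thesis
        using root_fps_nth_eq[OF char eq True] by (simp flip: fps)
    next
      case False
      then show ?thesis
        using deg[OF b] deg[OF b'] by (simp add: coeff_eq_0)
    qed
  qed
  have ord: "order (inverse s) (Q c) = c s" if "s \<noteq> 0" "s \<in> A" for s c
  proof -
    have "order (inverse s) (Q c) = (\<Sum>t\<in>A. order (inverse s) ([:1, - t:] ^ c t))"
      unfolding Q_def by (intro order_prod A) auto
    also have "\<dots> = (\<Sum>t\<in>A. if t = s then c t else 0)"
      by (simp only: order_linear_factor_power[OF that(1)])
    also have "\<dots> = c s" using A that by simp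
    finally show ?thesis .
  qed
  have nz: "b s = b' s" if "s \<noteq> 0" for s
    using ord[OF that, of b] ord[OF that, of b'] QQ b b'
    by (cases "s \<in> A") (auto simp: weak_compositions_def)
  have "b 0 = b' 0"
  proof (cases "0 \<in> A")
    case True
    have "b 0 + sum b (A - {0}) = b' 0 + sum b' (A - {0})"
      using b b' A True by (simp add: weak_compositions_def flip: sum.remove)
    moreover have "sum b (A - {0}) = sum b' (A - {0})"
      by (intro sum.cong) (auto simp: nz)
    ultimately show ?thesis by simp
  qed (use b b' in \<open>auto simp: weak_compositions_def\<close>)
  with nz show ?thesis by (metis ext)
qed

section \<open>Grouping by partitions\<close>

lemma sum_card_fibres:
  fixes l :: "'i \<Rightarrow> 'j" and h :: "'j \<Rightarrow> nat"
  assumes "finite I" "finite J" "l ` I \<subseteq> J"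
  shows "(\<Sum>j\<in>J. h j * card {i \<in> I. l i = j}) = (\<Sum>i\<in>I. h (l i))"
proof -
  have "(\<Sum>i\<in>I. h (l i)) = (\<Sum>j\<in>J. \<Sum>i | i \<in> I \<and> l i = j. h (l i))"
    by (rule sum.group[symmetric]) (use assms in auto)
  also have "\<dots> = (\<Sum>j\<in>J. h j * card {i \<in> I. l i = j})"
    by (intro sum.cong refl) (simp add: mult.commute)
  finally show ?thesis ..
qed

lemma prod_card_fibres:
  fixes l :: "'i \<Rightarrow> 'j" and h :: "'j \<Rightarrow> 'b::comm_semiring_1"
  assumes "finite I" "finite J" "l ` I \<subseteq> J"
  shows "(\<Prod>j\<in>J. h j ^ card {i \<in> I. l i = j}) = (\<Prod>i\<in>I. h (l i))"
proof -
  have "(\<Prod>i\<in>I. h (l i)) = (\<Prod>j\<in>J. \<Prod>i | i \<in> I \<and> l i = j. h (l i))"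
    by (rule prod.group[symmetric]) (use assms in auto)
  also have "\<dots> = (\<Prod>j\<in>J. h j ^ card {i \<in> I. l i = j})"
    by (intro prod.cong refl) simp
  finally show ?thesis ..
qed

lemma partitions_of_le:
  assumes "l \<in> partitions_of d" "i \<in> {1..d}"
  shows "l i \<le> d"
  using assms member_le_sum[of i "{1..d}" l] by (simp add: partitions_of_def)

lemma count_mset_map_upt:
  "count (mset (map l [1..<Suc d])) j = card {i \<in> {1..d}. l i = j}"
proof -
  have "count (mset (map l [1..<Suc d])) j = length (filter (\<lambda>i. l i = j) [1..<Suc d])"
    unfolding count_mset count_list_eq_length_filter filter_map length_map o_def by (simp only: eq_commute[of j])
  also have "\<dots> = card (set (filter (\<lambda>i. l i = j) [1..<Suc d]))"
    by (rule distinct_card[symmetric]) (simp del: upt_Suc)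
  also have "set (filter (\<lambda>i. l i = j) [1..<Suc d]) = {i \<in> {1..d}. l i = j}"
    by auto
  finally show ?thesis .
qed

text \<open>
  The possible sequences of part multiplicities \<open>c\<close> of a partition of \<open>d\<close> into \<open>q\<close> parts, where
  zero parts are allowed: \<open>c j\<close> is the number of parts equal to \<open>j\<close>.
\<close>
definition part_profiles :: "nat \<Rightarrow> nat \<Rightarrow> (nat \<Rightarrow> nat) set" where
  "part_profiles q d = {c \<in> weak_compositions {0..d} q. (\<Sum>j=0..d. j * c j) = d}"

lemma part_mult_in_part_profiles:
  assumes "d \<le> q" "l \<in> partitions_of d"
  shows "part_mult q d l \<in> part_profiles q d"
proof -
  have im: "l ` {1..d} \<subseteq> {0..d}"
    using partitions_of_le[OF assms(2)] by auto
  have "part_mult q d l j = 0" if "j \<notin> {0..d}" for j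
  proof -
    have "{i \<in> {1..d}. l i = j} = {}"
      using partitions_of_le[OF assms(2)] that by fastforce
    then show ?thesis
      using that by (simp add: part_mult_def)
  qed
  moreover have "(\<Sum>j\<in>{0..d}. part_mult q d l j) = q"
    using sum_card_fibres[OF _ _ im, of "\<lambda>_. 1"] assms(1)
    by (simp add: part_mult_def sum.distrib)
  moreover have "(\<Sum>j=0..d. j * part_mult q d l j) = (\<Sum>j=0..d. j * card {i \<in> {1..d}. l i = j})"
    by (intro sum.cong) (auto simp: part_mult_def)
  moreover have "\<dots> = d"
    using sum_card_fibres[OF _ _ im, of "\<lambda>j. j"] assms(2) by (simp add: partitions_of_def)
  ultimately show ?thesis
    by (auto simp: part_profiles_def weak_compositions_def)
qed

lemma sorted_rev_partition:
  assumes "l \<in> partitions_of d"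
  shows "sorted (rev (map l [1..<Suc d]))"
proof -
  have "antimono_on {1..d} l"
    using assms by (simp add: partitions_of_def)
  then have "sorted_wrt (\<ge>) (map l [1..<Suc d])"
    unfolding sorted_wrt_map
    by (intro sorted_wrt_mono_rel[OF _ sorted_wrt_upt]) (auto simp: monotone_on_def)
  then show ?thesis
    by (simp add: sorted_wrt_rev del: upt_Suc)
qed

lemma inj_on_part_mult: "inj_on (part_mult q d) (partitions_of d)"
proof (rule inj_onI)
  fix l l' assume l: "l \<in> partitions_of d" and l': "l' \<in> partitions_of d"
    and eq: "part_mult q d l = part_mult q d l'"
  have "card {i \<in> {1..d}. l i = j} = card {i \<in> {1..d}. l' i = j}" for j
    using fun_cong[OF eq, of j] by (simp add: part_mult_def)
  then have "mset (rev (map l [1..<Suc d])) = mset (rev (map l' [1..<Suc d]))"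
    unfolding mset_rev by (intro multiset_eqI) (simp only: count_mset_map_upt)
  then have "rev (map l [1..<Suc d]) = rev (map l' [1..<Suc d])"
    using sorted_rev_partition[OF l] sorted_rev_partition[OF l'] properties_for_sort by metis
  then have "map l [1..<Suc d] = map l' [1..<Suc d]"
    by (simp only: rev_is_rev_conv)
  then have ll': "\<forall>i\<in>set [1..<Suc d]. l i = l' i"
    by (simp only: map_eq_conv)
  have "l \<in> {1..d} \<rightarrow>\<^sub>E UNIV" "l' \<in> {1..d} \<rightarrow>\<^sub>E UNIV"
    using l l' by (simp_all add: partitions_of_def)
  then show "l = l'"
    by (rule PiE_ext) (use ll' in \<open>auto simp del: upt_Suc\<close>)
qed

text \<open>
  Of the \<open>q\<close> parts at most \<open>d\<close> are positive.  Discarding \<open>q - d\<close> zero parts and listing the others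
  in decreasing order gives the partition.
\<close>
lemma part_profiles_subset_image:
  assumes "d \<le> q" "c \<in> part_profiles q d"
  shows "c \<in> part_mult q d ` partitions_of d"
proof -
  have c: "sum c {0..d} = q" "(\<Sum>j=0..d. j * c j) = d" "\<And>j. j \<notin> {0..d} \<Longrightarrow> c j = 0"
    using assms(2) by (auto simp: part_profiles_def weak_compositions_def)
  define c' where "c' j = c j - (if j = 0 then q - d else 0)" for j
  have "(\<Sum>j=1..d. c j) \<le> (\<Sum>j=1..d. j * c j)"
    by (intro sum_mono) auto
  also have "\<dots> \<le> (\<Sum>j=0..d. j * c j)"
    by (intro sum_mono2) auto
  finally have "(\<Sum>j=1..d. c j) \<le> d" using c by simp
  moreover have "c 0 + (\<Sum>j=1..d. c j) = q"
    using c(1) by (simp add: sum.atLeast_Suc_atMost)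
  ultimately have "q - d \<le> c 0" by linarith
  then have c_eq: "c j = c' j + (if j = 0 then q - d else 0)" for j
    by (simp add: c'_def)
  have sum_c': "sum c' {0..d} = d"
    using c(1) assms(1) unfolding c_eq by (simp add: sum.distrib)
  define M where "M = (\<Sum>j\<in>{0..d}. replicate_mset (c' j) j)"
  have count_M: "count M j = c' j" for j
    using c(3)[of j] by (auto simp: M_def count_sum c'_def)
  have "size M = d"
    by (simp add: M_def sum_c')
  define xs where "xs = rev (sorted_list_of_multiset M)"
  have len: "length xs = d"
    using \<open>size M = d\<close> by (simp add: xs_def flip: size_mset)
  have desc: "sorted_wrt (\<ge>) xs"
    by (simp add: xs_def sorted_wrt_rev)
  define l where "l = (\<lambda>i\<in>{1..d}. xs ! (i - 1))"
  have xs_eq: "xs = map l [1..<Suc d]"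
    by (rule nth_equalityI) (auto simp: l_def len simp del: upt_Suc)
  have card_l: "card {i \<in> {1..d}. l i = j} = c' j" for j
    by (simp only: count_mset_map_upt[symmetric] xs_eq[symmetric]) (simp add: xs_def count_M)
  have im: "l ` {1..d} \<subseteq> {0..d}"
  proof
    fix j assume "j \<in> l ` {1..d}"
    then have "card {i \<in> {1..d}. l i = j} > 0"
      unfolding card_gt_0_iff by auto
    then have "c' j > 0"
      by (simp only: card_l)
    then show "j \<in> {0..d}"
      using c(3)[of j] by (cases "j \<in> {0..d}") (auto simp: c'_def)
  qed
  have "(\<Sum>i=1..d. l i) = (\<Sum>j=0..d. j * c' j)"
    using sum_card_fibres[OF _ _ im, of "\<lambda>j. j"] unfolding card_l by simp
  also have "\<dots> = (\<Sum>j=0..d. j * c j)"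
    by (intro sum.cong) (auto simp: c'_def)
  finally have "(\<Sum>i=1..d. l i) = d" using c by simp
  moreover have "antimono_on {1..d} l"
  proof (rule monotone_onI)
    fix i j assume "i \<in> {1..d}" "j \<in> {1..d}" "i \<le> j"
    then show "l j \<le> l i"
      using sorted_wrt_nth_less[OF desc, of "i - 1" "j - 1"] len by (cases "i = j") (auto simp: l_def)
  qed
  ultimately have "l \<in> partitions_of d"
    by (simp add: partitions_of_def l_def)
  moreover have "part_mult q d l = c"
    by (rule ext) (simp only: part_mult_def card_l c_eq)
  ultimately show ?thesis by blast
qed

lemma bij_betw_part_mult:
  assumes "d \<le> q"
  shows "bij_betw (part_mult q d) (partitions_of d) (part_profiles q d)"
  unfolding bij_betw_def
  using inj_on_part_mult part_mult_in_part_profiles[OF assms] part_profiles_subset_image[OF assms]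
  by blast

lemma multinomial_partition:
  assumes "l \<in> partitions_of d"
  shows "multinomial d {1..d} l = fact d / (\<Prod>j=0..d. fact j ^ part_mult q d l j)"
proof -
  have im: "l ` {1..d} \<subseteq> {0..d}"
    using partitions_of_le[OF assms] by auto
  have "(\<Prod>j=0..d. fact j ^ part_mult q d l j) = (\<Prod>j=0..d. (fact j :: real) ^ card {i \<in> {1..d}. l i = j})"
    by (intro prod.cong) (auto simp: part_mult_def)
  also have "\<dots> = (\<Prod>i=1..d. fact (l i))"
    by (rule prod_card_fibres[OF _ _ im]) auto
  finally show ?thesis by (simp add: multinomial_def)
qed

lemma fps_prod_const_X_power:
  fixes a :: "'j \<Rightarrow> 'b::comm_ring_1"
  shows "(\<Prod>j\<in>J. (fps_const (a j) * fps_X ^ e j) ^ c j)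
       = fps_const (\<Prod>j\<in>J. a j ^ c j) * fps_X ^ (\<Sum>j\<in>J. e j * c j)"
  by (induction J rule: infinite_finite_induct)
    (simp_all add: power_mult_distrib fps_const_power power_add mult_ac
      flip: power_mult fps_const_mult)

text \<open>
  The coefficient is unchanged when the series is truncated after degree \<open>d\<close>; then the \<open>q\<close>-th power
  is expanded by the multinomial theorem over the degrees \<open>0, \<dots>, d\<close>.  The index \<open>c\<close> of a summand
  counts how many of the \<open>q\<close> factors contribute degree \<open>j\<close>.
\<close>
theorem sum_partitions_eq:
  assumes A: "finite A" "card A = q" and "d \<le> q"
  shows "(\<Sum>l\<in>partitions_of d. (multinomial d {1..d} l)\<^sup>2 * multinomial q {0..d} (part_mult q d l))
       = (fact d)\<^sup>2 * fps_nth (\<Prod>t\<in>A. bessel_fps 1) d"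
proof -
  define B :: "real fps" where "B = (\<Sum>j\<in>{0..d}. fps_const (1 / (fact j)\<^sup>2) * fps_X ^ j)"
  have B_nth: "fps_nth B k = fps_nth (bessel_fps 1) k" if "k \<le> d" for k
  proof -
    have "fps_nth B k = (\<Sum>j\<in>{0..d}. if j = k then 1 / (fact j)\<^sup>2 else 0)"
      unfolding B_def fps_sum_nth by (intro sum.cong) (auto simp: fps_X_power_nth)
    then show ?thesis using that by (simp add: bessel_fps_nth)
  qed
  have "fps_nth (\<Prod>t\<in>A. bessel_fps 1) d = fps_nth (\<Prod>t\<in>A. B) d"
    unfolding fps_prod_nth_weak_compositions[OF A(1)]
    by (intro sum.cong refl prod.cong B_nth[symmetric] weak_compositions_le[OF A(1)])
  then have "fps_nth (\<Prod>t\<in>A. bessel_fps 1) d = fps_nth (B ^ q) d"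
    using A by simp
  moreover have "B ^ q = (\<Sum>c\<in>weak_compositions {0..d} q.
      of_nat (fact q div (\<Prod>j\<in>{0..d}. fact (c j))) *
      (\<Prod>j\<in>{0..d}. (fps_const (1 / (fact j)\<^sup>2) * fps_X ^ j) ^ c j))"
    unfolding B_def by (rule multinomial_theorem) simp
  ultimately have "fps_nth (\<Prod>t\<in>A. bessel_fps 1) d = (\<Sum>c\<in>weak_compositions {0..d} q.
      fps_nth (fps_const (multinomial q {0..d} c) *
        (fps_const (\<Prod>j\<in>{0..d}. (1 / (fact j)\<^sup>2) ^ c j) * fps_X ^ (\<Sum>j\<in>{0..d}. j * c j))) d)"
    by (simp only: fps_sum_nth fps_prod_const_X_power fps_of_nat[symmetric]
        of_nat_fact_div_prod_fact[OF finite_atLeastAtMost] multinomial_def cong: sum.cong)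
  also have "\<dots> = (\<Sum>c\<in>weak_compositions {0..d} q. if (\<Sum>j\<in>{0..d}. j * c j) = d then
      multinomial q {0..d} c * (\<Prod>j\<in>{0..d}. (1 / (fact j)\<^sup>2) ^ c j) else 0)"
    by (intro sum.cong refl) (simp add: fps_X_power_nth del: of_nat_prod)
  also have "\<dots> = (\<Sum>c\<in>part_profiles q d.
      multinomial q {0..d} c * (\<Prod>j\<in>{0..d}. (1 / (fact j)\<^sup>2) ^ c j))"
    unfolding part_profiles_def
    by (rule sum.inter_filter[symmetric]) (simp add: finite_weak_compositions)
  also have "\<dots> = (\<Sum>l\<in>partitions_of d. multinomial q {0..d} (part_mult q d l) *
      (\<Prod>j\<in>{0..d}. (1 / (fact j)\<^sup>2) ^ part_mult q d l j))"
    by (rule sum.reindex_bij_betw[OF bij_betw_part_mult[OF \<open>d \<le> q\<close>], symmetric])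
  finally have nth_eq: "fps_nth (\<Prod>t\<in>A. bessel_fps 1) d
    = (\<Sum>l\<in>partitions_of d. multinomial q {0..d} (part_mult q d l) *
      (\<Prod>j\<in>{0..d}. (1 / (fact j)\<^sup>2) ^ part_mult q d l j))" .
  have "(fact d)\<^sup>2 * fps_nth (\<Prod>t\<in>A. bessel_fps 1) d = (\<Sum>l\<in>partitions_of d.
      (multinomial d {1..d} l)\<^sup>2 * multinomial q {0..d} (part_mult q d l))"
    unfolding nth_eq sum_distrib_left
  proof (intro sum.cong refl)
    fix l assume l: "l \<in> partitions_of d"
    have "(\<Prod>j\<in>{0..d}. (1 / (fact j)\<^sup>2) ^ part_mult q d l j)
        = (1 / (\<Prod>j=0..d. (fact j :: real) ^ part_mult q d l j))\<^sup>2"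
      by (simp add: power_divide prod_dividef prod_power_distrib mult.commute flip: power_mult)
    then show "(fact d)\<^sup>2 * (multinomial q {0..d} (part_mult q d l) *
          (\<Prod>j\<in>{0..d}. (1 / (fact j)\<^sup>2) ^ part_mult q d l j))
        = (multinomial d {1..d} l)\<^sup>2 * multinomial q {0..d} (part_mult q d l)"
      unfolding multinomial_partition[OF l, of q] by (simp add: power_divide)
  qed
  then show ?thesis ..
qed

section \<open>The sharp extension inequality\<close>

lemma sum_moment_curve:
  fixes h :: "(nat \<Rightarrow> 'a::{finite, field}) \<Rightarrow> 'b::comm_monoid_add"
  assumes "d \<ge> 1"
  shows "(\<Sum>\<xi>\<in>moment_curve d. h \<xi>) = (\<Sum>t\<in>UNIV. h (\<lambda>i\<in>{1..d}. t ^ i))"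
proof -
  have "inj (\<lambda>t::'a. \<lambda>i\<in>{1..d}. t ^ i)"
  proof (rule injI)
    fix s t :: 'a
    assume "(\<lambda>i\<in>{1..d}. s ^ i) = (\<lambda>i\<in>{1..d}. t ^ i)"
    from fun_cong[OF this, of 1] show "s = t" using assms by simp
  qed
  then show ?thesis
    unfolding moment_curve_def by (subst sum.reindex) (simp_all add: o_def)
qed

context finite_field_character
begin

text \<open>
  The frequency of the character belonging to \<open>b\<close> is the vector of power sums of \<open>b\<close>.
\<close>
lemma power_sum_extension:
  fixes g :: "'a \<Rightarrow> complex"
  shows "(\<Sum>t\<in>UNIV. g t * add_char p n (dot d x (\<lambda>i\<in>{1..d}. t ^ i))) ^ d
    = (\<Sum>b\<in>weak_compositions UNIV d.
        (of_nat (fact d div (\<Prod>t\<in>UNIV. fact (b t))) * (\<Prod>t\<in>UNIV. g t ^ b t)) *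
        add_char p n (dot d x (\<lambda>i. \<Sum>t\<in>UNIV. of_nat (b t) * t ^ i)))"
proof -
  have char: "(\<Prod>t\<in>UNIV. add_char p n (dot d x (\<lambda>i\<in>{1..d}. t ^ i)) ^ b t)
      = add_char p n (dot d x (\<lambda>i. \<Sum>t\<in>UNIV. of_nat (b t) * t ^ i))" for b :: "'a \<Rightarrow> nat"
  proof -
    have "(\<Sum>t\<in>UNIV. of_nat (b t) * dot d x (\<lambda>i\<in>{1..d}. t ^ i))
        = (\<Sum>t\<in>UNIV. \<Sum>i=1..d. x i * (of_nat (b t) * t ^ i))"
      by (simp add: dot_def sum_distrib_left mult_ac)
    also have "\<dots> = dot d x (\<lambda>i. \<Sum>t\<in>UNIV. of_nat (b t) * t ^ i)"
      unfolding dot_def sum_distrib_left by (rule sum.swap)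
    finally show ?thesis
      by (simp only: add_char_of_nat_mult[symmetric] add_char_sum[symmetric])
  qed
  show ?thesis
    unfolding multinomial_theorem[OF finite] power_mult_distrib prod.distrib char
    by (simp only: mult.assoc)
qed

text \<open>
  The \<open>2d\<close>-th power of the \<open>L\<^sup>2\<^sup>d\<close> norm, computed exactly.  Distinct \<open>b\<close> have distinct frequencies
  because \<open>d\<close> is less than the characteristic, so only the diagonal terms survive.
\<close>
lemma sum_cmod_extension_power:
  fixes f :: "(nat \<Rightarrow> 'a) \<Rightarrow> complex"
  assumes "1 \<le> d" "d < p"
  shows "(\<Sum>x\<in>vectors d. cmod (extension_op p n d f x) ^ (2 * d))
    = (fact d)\<^sup>2 / real CARD('a) ^ d *
      fps_nth (\<Prod>t\<in>UNIV. bessel_fps ((cmod (f (\<lambda>i\<in>{1..d}. t ^ i)))\<^sup>2)) d"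
proof -
  define g where "g t = f (\<lambda>i\<in>{1..d}. t ^ i)" for t
  define S where "S x = (\<Sum>t\<in>UNIV. g t * add_char p n (dot d x (\<lambda>i\<in>{1..d}. t ^ i)))" for x
  define W where "W = weak_compositions (UNIV :: 'a set) d"
  define C where "C b = of_nat (fact d div (\<Prod>t\<in>UNIV. fact (b t))) * (\<Prod>t\<in>UNIV. g t ^ b t)" for b
  define V where "V b i = (\<Sum>t\<in>UNIV. of_nat (b t) * (t :: 'a) ^ i)" for b i
  define q where "q = CARD('a)"
  have "q > 0" by (simp add: q_def)
  have S_power: "S x ^ d = (\<Sum>b\<in>W. C b * add_char p n (dot d x (V b)))" for x
    unfolding S_def C_def W_def V_def by (rule power_sum_extension)
  have abs2: "of_real (cmod (S x) ^ (2 * d))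
      = (\<Sum>b\<in>W. \<Sum>b'\<in>W. C b * cnj (C b') * add_char p n (dot d x (\<lambda>i. V b i - V b' i)))" for x
  proof -
    have "of_real (cmod (S x) ^ (2 * d)) = S x ^ d * cnj (S x ^ d)"
      by (simp only: power_mult of_real_power[of _ d] complex_norm_square power_mult_distrib
          complex_cnj_power)
    also have "\<dots> = (\<Sum>b\<in>W. \<Sum>b'\<in>W. C b * add_char p n (dot d x (V b)) *
        (cnj (C b') * add_char p n (- dot d x (V b'))))"
      unfolding S_power by (simp add: sum_product cnj_add_char)
    also have "\<dots> = (\<Sum>b\<in>W. \<Sum>b'\<in>W. C b * cnj (C b') *
        add_char p n (dot d x (\<lambda>i. V b i - V b' i)))"
    proof (intro sum.cong refl)
      fix b b'
      have "dot d x (\<lambda>i. V b i - V b' i) = dot d x (V b) + - dot d x (V b')"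
        by (simp add: dot_def sum_subtractf algebra_simps)
      then show "C b * add_char p n (dot d x (V b)) * (cnj (C b') * add_char p n (- dot d x (V b')))
          = C b * cnj (C b') * add_char p n (dot d x (\<lambda>i. V b i - V b' i))"
        by (simp only: add_char_add mult_ac)
    qed
    finally show ?thesis .
  qed
  have orth: "(\<Sum>x\<in>vectors d. add_char p n (dot d x (\<lambda>i. V b i - V b' i)))
      = (if b' = b then of_nat q ^ d else 0)" if "b \<in> W" "b' \<in> W" for b b'
  proof -
    have "b = b'" if "\<forall>i\<in>{1..d}. V b i - V b' i = 0"
    proof (rule power_sums_determine_multiplicities)
      show "b \<in> weak_compositions UNIV d" "b' \<in> weak_compositions UNIV d"
        using \<open>b \<in> W\<close> \<open>b' \<in> W\<close> by (auto simp: W_def)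
      show "of_nat k \<noteq> (0 :: 'a)" if "0 < k" "k \<le> d" for k
        using that \<open>d < p\<close> by (auto simp: of_nat_eq_0_iff_char_dvd CHAR_eq dest: dvd_imp_le)
      show "(\<Sum>t\<in>UNIV. of_nat (b t) * t ^ j) = (\<Sum>t\<in>UNIV. of_nat (b' t) * (t :: 'a) ^ j)"
        if "j \<in> {1..d}" for j
        using \<open>\<forall>i\<in>{1..d}. V b i - V b' i = 0\<close> that by (simp add: V_def)
    qed simp
    then show ?thesis
      unfolding sum_vectors_add_char q_def by auto
  qed
  have "of_real (\<Sum>x\<in>vectors d. cmod (S x) ^ (2 * d))
      = (\<Sum>x\<in>vectors d. \<Sum>b\<in>W. \<Sum>b'\<in>W.
          C b * cnj (C b') * add_char p n (dot d x (\<lambda>i. V b i - V b' i)))"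
    unfolding of_real_sum abs2 ..
  also have "\<dots> = (\<Sum>b\<in>W. \<Sum>b'\<in>W. C b * cnj (C b') *
      (\<Sum>x\<in>vectors d. add_char p n (dot d x (\<lambda>i. V b i - V b' i))))"
    unfolding sum_distrib_left sum.swap[of _ _ "vectors d"] ..
  also have "\<dots> = (\<Sum>b\<in>W. \<Sum>b'\<in>W. if b' = b then C b * cnj (C b') * of_nat q ^ d else 0)"
    by (intro sum.cong refl) (simp add: orth)
  also have "\<dots> = (\<Sum>b\<in>W. C b * cnj (C b) * of_nat q ^ d)"
    by (intro sum.cong refl) (simp add: W_def finite_weak_compositions)
  also have "\<dots> = of_real (real q ^ d * (\<Sum>b\<in>W. (cmod (C b))\<^sup>2))"
    by (simp add: sum_distrib_left mult_ac flip: complex_norm_square)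
  finally have S_sum: "(\<Sum>x\<in>vectors d. cmod (S x) ^ (2 * d)) = real q ^ d * (\<Sum>b\<in>W. (cmod (C b))\<^sup>2)"
    by (simp only: of_real_eq_iff)
  have C_sum: "(\<Sum>b\<in>W. (cmod (C b))\<^sup>2) = (fact d)\<^sup>2 * fps_nth (\<Prod>t\<in>UNIV. bessel_fps ((cmod (g t))\<^sup>2)) d"
    unfolding prod_bessel_fps_nth_expand[OF finite] W_def
  proof (intro sum.cong refl)
    fix b :: "'a \<Rightarrow> nat" assume b: "b \<in> weak_compositions UNIV d"
    have "cmod (C b) = fact d / (\<Prod>t\<in>UNIV. fact (b t)) * (\<Prod>t\<in>UNIV. cmod (g t) ^ b t)"
      unfolding C_def of_nat_fact_div_prod_fact[OF finite b]
      by (simp add: norm_mult norm_divide norm_power prod_norm[symmetric])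
    then show "(cmod (C b))\<^sup>2 = (fact d / (\<Prod>t\<in>UNIV. fact (b t)))\<^sup>2 * (\<Prod>t\<in>UNIV. (cmod (g t))\<^sup>2 ^ b t)"
      by (simp add: power_divide power_mult_distrib prod_power_distrib mult.commute flip: power_mult)
  qed
  have "cmod (extension_op p n d f x) ^ (2 * d) = cmod (S x) ^ (2 * d) / (real q ^ d * real q ^ d)" for x
    unfolding extension_op_def sum_moment_curve[OF assms(1)]
    by (simp add: S_def g_def q_def norm_divide power_divide mult_2 power_add)
  then have "(\<Sum>x\<in>vectors d. cmod (extension_op p n d f x) ^ (2 * d))
      = (real q ^ d * ((fact d)\<^sup>2 * fps_nth (\<Prod>t\<in>UNIV. bessel_fps ((cmod (g t))\<^sup>2)) d)) /
        (real q ^ d * real q ^ d)"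
    by (simp only: sum_divide_distrib[symmetric] S_sum C_sum)
  then show ?thesis
    using \<open>q > 0\<close> by (simp add: q_def g_def)
qed

end

lemma power_powr_half:
  fixes m :: real
  assumes "0 \<le> m" "d \<ge> 1"
  shows "(m ^ d) powr (1 / (2 * real d)) = sqrt m"
proof (cases "m = 0")
  case False
  then have "m > 0" using assms by simp
  then show ?thesis
    using assms by (simp add: powr_powr powr_half_sqrt flip: powr_realpow)
qed (use assms in auto)

theorem theorem3:
  fixes d p n q :: nat
  assumes "d \<ge> 2"
    and "prime p" and "p > d"
    and "n \<ge> 1" and "q = p ^ n"
    and "CARD('a::{finite, field}) = q"
    and "real q \<ge> real d * (real d - 1) / (2 * ln 6) + (2 * real d - 1) / 3"
  shows "(\<forall>f :: (nat \<Rightarrow> 'a) \<Rightarrow> complex.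
            Lp_norm_vectors (2 * real d) d (extension_op p n d f)
              \<le> sharp_const q d * L2_norm_curve d f)
       \<and> (\<forall>C::real.
            (\<forall>f :: (nat \<Rightarrow> 'a) \<Rightarrow> complex.
               Lp_norm_vectors (2 * real d) d (extension_op p n d f) \<le> C * L2_norm_curve d f)
            \<longrightarrow> sharp_const q d \<le> C)
       \<and> (\<forall>f :: (nat \<Rightarrow> 'a) \<Rightarrow> complex.
            (\<exists>\<xi>\<in>moment_curve d. f \<xi> \<noteq> 0) \<longrightarrow>
              (Lp_norm_vectors (2 * real d) d (extension_op p n d f)
                 = sharp_const q d * L2_norm_curve d f
               \<longleftrightarrow> (\<exists>c::real. \<forall>\<xi>\<in>moment_curve d. cmod (f \<xi>) = c)))"
proof -
  interpret finite_field_character p n "TYPE('a)"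
    using assms by unfold_locales auto
  define \<gamma> :: "'a \<Rightarrow> nat \<Rightarrow> 'a" where "\<gamma> t = (\<lambda>i\<in>{1..d}. t ^ i)" for t
  have d1: "d \<ge> 1" using assms by simp
  have q0: "q > 0" using assms(6) by (metis zero_less_card_finite)
  have "d \<le> q"
    using assms(3,4,5) self_le_power[of p n] by (simp add: assms(2) prime_gt_0_nat)
  define K :: real where "K = (fact d)\<^sup>2 / real q ^ d"
  have K0: "K > 0" using q0 by (simp add: K_def)
  \<comment> \<open>\<open>K * \<Phi> (a f)\<close> is the \<open>2d\<close>-th power of the left-hand side, \<open>m f\<close> is the square of the \<open>L\<^sup>2\<close> norm,
    and homogeneity of \<open>\<Phi>\<close> turns the right-hand side into the same expression at the mean of \<open>a f\<close>.\<close>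
  define \<Phi> where "\<Phi> a = fps_nth (\<Prod>t\<in>(UNIV :: 'a set). bessel_fps (a t)) d" for a
  define a where "a f t = (cmod (f (\<gamma> t)))\<^sup>2" for f :: "(nat \<Rightarrow> 'a) \<Rightarrow> complex" and t
  define m where "m f = (\<Sum>t\<in>UNIV. a f t) / real q" for f
  define e where "e = 1 / (2 * real d)"
  have e0: "e > 0" using d1 by (simp add: e_def)
  have m0: "m f \<ge> 0" for f
    by (auto simp: m_def a_def intro!: divide_nonneg_nonneg sum_nonneg)
  have Lp: "Lp_norm_vectors (2 * real d) d (extension_op p n d f) = (K * \<Phi> (a f)) powr e" for f
  proof -
    have "cmod z powr (2 * real d) = cmod z ^ (2 * d)" for z
      using powr_realpow'[of "cmod z" "2 * d"] d1 by simp
    then show ?thesis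
      unfolding Lp_norm_vectors_def sum_cmod_extension_power[OF d1 assms(3)]
      by (simp add: sum_cmod_extension_power[OF d1 assms(3)] K_def \<Phi>_def a_def \<gamma>_def e_def assms(6))
  qed
  have sharp: "sharp_const q d = (K * \<Phi> (\<lambda>_. 1)) powr e"
    unfolding sharp_const_def sum_partitions_eq[OF finite assms(6) \<open>d \<le> q\<close>]
    by (simp add: K_def \<Phi>_def e_def)
  have L2: "L2_norm_curve d f = (m f ^ d) powr e" for f
    unfolding e_def power_powr_half[OF m0 d1] L2_norm_curve_def sum_moment_curve[OF d1]
    by (simp add: m_def a_def \<gamma>_def assms(6))
  have \<Phi>_const: "\<Phi> (\<lambda>_. \<mu>) = \<mu> ^ d * \<Phi> (\<lambda>_. 1)" for \<mu>
    unfolding \<Phi>_def by (rule prod_bessel_fps_const_nth) simp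
  have \<Phi>_nonneg: "0 \<le> \<Phi> (a f)" for f
    unfolding \<Phi>_def by (rule prod_bessel_fps_nth_nonneg) (simp add: a_def)
  have \<Phi>_const_nonneg: "0 \<le> \<Phi> (\<lambda>_. \<mu>)" if "0 \<le> \<mu>" for \<mu>
    unfolding \<Phi>_def by (rule prod_bessel_fps_nth_nonneg) (rule that)
  have rhs: "sharp_const q d * L2_norm_curve d f = (K * \<Phi> (\<lambda>_. m f)) powr e" for f
    unfolding sharp L2 \<Phi>_const[of "m f"]
    using K0 m0[of f] \<Phi>_const_nonneg[of 1] by (simp add: powr_mult[symmetric] mult_ac)
  have strict: "(K * \<Phi> (a f)) powr e < (K * \<Phi> (\<lambda>_. m f)) powr e" if "\<exists>t. a f t \<noteq> m f" for f
  proof -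
    have "\<Phi> (a f) < \<Phi> (\<lambda>_. m f)"
      unfolding \<Phi>_def
      by (rule prod_bessel_fps_less_mean) (use that assms(1,6) q0 in \<open>auto simp: a_def m_def\<close>)
    then show ?thesis
      using K0 e0 \<Phi>_nonneg[of f] by (intro powr_less_mono2) auto
  qed
  have const: "(K * \<Phi> (a f)) powr e = (K * \<Phi> (\<lambda>_. m f)) powr e" if "\<forall>t. a f t = m f" for f
  proof -
    have "a f = (\<lambda>_. m f)" using that by blast
    then show ?thesis by simp
  qed
  have eq_iff: "(K * \<Phi> (a f)) powr e = (K * \<Phi> (\<lambda>_. m f)) powr e \<longleftrightarrow> (\<forall>t. a f t = m f)" for f
    using strict[of f] const[of f] by (metis less_irrefl)
  have const_iff: "(\<forall>t. a f t = m f) \<longleftrightarrow> (\<exists>c::real. \<forall>\<xi>\<in>moment_curve d. cmod (f \<xi>) = c)" for f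
  proof
    assume *: "\<forall>t. a f t = m f"
    have "cmod (f (\<gamma> t)) = sqrt (m f)" for t
      using *[rule_format, of t, symmetric] by (simp add: a_def)
    then show "\<exists>c::real. \<forall>\<xi>\<in>moment_curve d. cmod (f \<xi>) = c"
      by (auto simp: moment_curve_def \<gamma>_def)
  next
    assume "\<exists>c::real. \<forall>\<xi>\<in>moment_curve d. cmod (f \<xi>) = c"
    then obtain c where c: "\<And>\<xi>. \<xi> \<in> moment_curve d \<Longrightarrow> cmod (f \<xi>) = c" by blast
    have "a f t = c\<^sup>2" for t
      using c[of "\<gamma> t"] by (simp add: a_def moment_curve_def \<gamma>_def)
    then show "\<forall>t. a f t = m f"
      using q0 by (simp add: m_def assms(6))
  qed
  have ineq: "Lp_norm_vectors (2 * real d) d (extension_op p n d f) \<le> sharp_const q d * L2_norm_curve d f"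
    for f :: "(nat \<Rightarrow> 'a) \<Rightarrow> complex"
    unfolding rhs Lp using strict[of f] const[of f] by (metis less_imp_le order_refl)
  have sharpness: "sharp_const q d \<le> C"
    if "\<And>f :: (nat \<Rightarrow> 'a) \<Rightarrow> complex.
      Lp_norm_vectors (2 * real d) d (extension_op p n d f) \<le> C * L2_norm_curve d f" for C
  proof -
    have "m (\<lambda>_. 1) = 1" and "a (\<lambda>_. 1) = (\<lambda>_. 1)"
      using q0 by (simp_all add: m_def a_def fun_eq_iff assms(6))
    then show ?thesis
      using that[of "\<lambda>_. 1"] unfolding Lp L2 sharp by simp
  qed
  show ?thesis
    using ineq sharpness by (simp add: rhs Lp eq_iff const_iff)
qed

end
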